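(* Let $q$ be a power of a prime $p$, let $U$ be a Sylow $p$-subgroup of the Steinberg triality group ${}^3D_4(q^3)$, and let $k(U)$ be the number of conjugacy classes of $U$. If $q$ is odd, then $$k(U)=2q^5+2q^4-q^3-q^2-q.$$ If $q$ is even, then $$k(U)=2q^5+5q^4-4q^3-q^2-4q+3.$$
   Context: ${}^3D_4(q^3)$ denotes the Steinberg triality group defined over $\mathbb{F}_{q^3}$ (obtained from the Chevalley group $D_4(q^3)$), whose Sylow $p$-subgroup has order $q^{12}$. Concretely, $U$ can be taken as follows. Write $[x,y]=x^{-1}y^{-1}xy$. Let $U\!D_4(q^3)$ be the Sylow $p$-subgroup (maximal unipotent subgroup) of $D_4(q^3)$ generated by the root elements $x_i(t)=x_{\alpha_i}(t)$, $1\le i\le 12$, $t\in\mathbb{F}_{q^3}$, where $\alpha_1,\dots,\alpha_{12}$ are the positive roots of type $D_4$: $\alpha_1$ is the simple root at the central node, $\alpha_2,\alpha_3,\alpha_4$ are the other simple roots, $\alpha_5=\alpha_1+\alpha_2$, $\alpha_6=\alpha_1+\alpha_3$, $\alpha_7=\alpha_1+\alpha_4$, $\alpha_8=\alpha_1+\alpha_2+\alpha_3$, $\alpha_9=\alpha_1+\alpha_3+\alpha_4$, $\alpha_{10}=\alpha_1+\alpha_2+\alpha_4$, $\alpha_{11}=\alpha_1+\alpha_2+\alpha_3+\alpha_4$, $\alpha_{12}=2\alpha_1+\alpha_2+\alpha_3+\alpha_4$. Every element is uniquely a product $x_1(t_1)\cdots x_{12}(t_{12})$, one has $x_i(t)x_i(u)=x_i(t+u)$,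 and the structure constants are chosen so that $[x_1(t),x_2(u)]=x_5(tu)$, $[x_1(t),x_3(u)]=x_6(tu)$, $[x_1(t),x_4(u)]=x_7(tu)$, $[x_1(t),x_{11}(u)]=x_{12}(tu)$, $[x_2(t),x_6(u)]=x_8(tu)$, $[x_2(t),x_7(u)]=x_{10}(tu)$, $[x_2(t),x_9(u)]=x_{11}(tu)$, $[x_3(t),x_5(u)]=x_8(tu)$, $[x_3(t),x_7(u)]=x_9(tu)$, $[x_3(t),x_{10}(u)]=x_{11}(tu)$, $[x_4(t),x_5(u)]=x_{10}(tu)$, $[x_4(t),x_6(u)]=x_9(tu)$, $[x_4(t),x_8(u)]=x_{11}(tu)$, $[x_5(t),x_9(u)]=x_{12}(tu)$, $[x_6(t),x_{10}(u)]=x_{12}(tu)$, $[x_7(t),x_8(u)]=x_{12}(tu)$, where all $[x_i(t),x_j(u)]$ with neither $[x_i,x_j]$ nor $[x_j,x_i]$ listed are $1$. Let $\gamma=(2,3,4)(5,6,7)(8,9,10)$ and let $\sigma$ be the automorphism of $U\!D_4(q^3)$ with $\sigma(x_i(t))=x_{\gamma(i)}(t^q)$. Then $U$ is the subgroup of $\sigma$-fixed points of $U\!D_4(q^3)$. *)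

theory Defs
  imports "HOL-Algebra.Group_Action" "HOL-Combinatorics.Cycles" "HOL-Number_Theory.Residues"
begin

definition class_number :: "('a, 'b) monoid_scheme \<Rightarrow> nat"
  where "class_number G =
    card (orbits G (carrier G) (\<lambda>g. \<lambda>h\<in>carrier G. g \<otimes>\<^bsub>G\<^esub> h \<otimes>\<^bsub>G\<^esub> inv\<^bsub>G\<^esub> g))"

definition commutator :: "('a, 'b) monoid_scheme \<Rightarrow> 'a \<Rightarrow> 'a \<Rightarrow> 'a"
  where "commutator G g h = inv\<^bsub>G\<^esub> g \<otimes>\<^bsub>G\<^esub> inv\<^bsub>G\<^esub> h \<otimes>\<^bsub>G\<^esub> g \<otimes>\<^bsub>G\<^esub> h"

definition fixed_subgroup :: "('a, 'b) monoid_scheme \<Rightarrow> ('a \<Rightarrow> 'a) \<Rightarrow> ('a, 'b) monoid_scheme"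
  where "fixed_subgroup G \<sigma> = G\<lparr>carrier := {g \<in> carrier G. \<sigma> g = g}\<rparr>"

text \<open>
  The positive roots of type D4 are numbered as follows: 1 is the simple root at the central node,
  2, 3, 4 are the other simple roots, and
  5 = 1+2, 6 = 1+3, 7 = 1+4, 8 = 1+2+3, 9 = 1+3+4, 10 = 1+2+4, 11 = 1+2+3+4, 12 = 1+1+2+3+4.
  A triple (i, j, k) below means that root k is the sum of roots i and j and that the structure
  constant of the pair (i, j) is +1 (so that of (j, i) is -1).
\<close>

definition D4_triples :: "(nat \<times> nat \<times> nat) set"
  where "D4_triples =
    {(1, 2, 5), (1, 3, 6), (1, 4, 7), (1, 11, 12),
     (2, 6, 8), (2, 7, 10), (2, 9, 11),
     (3, 5, 8), (3, 7, 9), (3, 10, 11),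
     (4, 5, 10), (4, 6, 9), (4, 8, 11),
     (5, 9, 12), (6, 10, 12), (7, 8, 12)}"

text \<open>
  The maximal unipotent subgroup of the Chevalley group of type D4 over a field, given by its root
  elements \<open>x i t\<close> and Chevalley's commutator relations. These data determine the group up to
  isomorphism; that they are realised is shown at the end of this theory.
\<close>

locale UD4 = group G
  for G :: "('a, 'b) monoid_scheme" (structure) +
  fixes x :: "nat \<Rightarrow> 'k::field \<Rightarrow> 'a"
  assumes x_closed: "i \<in> {1..12} \<Longrightarrow> x i t \<in> carrier G"
    and x_add: "i \<in> {1..12} \<Longrightarrow> x i t \<otimes> x i u = x i (t + u)"
    and comm_x: "(i, j, k) \<in> D4_triples \<Longrightarrow> commutator G (x i t) (x j u) = x k (t * u)"
    and comm_x_trivial: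
      "\<lbrakk>i \<in> {1..12}; j \<in> {1..12}; \<And>k. (i, j, k) \<notin> D4_triples \<and> (j, i, k) \<notin> D4_triples\<rbrakk>
        \<Longrightarrow> commutator G (x i t) (x j u) = \<one>"
    and unique_product:
      "g \<in> carrier G \<Longrightarrow> \<exists>!t. t \<in> {1..12::nat} \<rightarrow>\<^sub>E UNIV \<and>
        g = x 1 (t 1) \<otimes> x 2 (t 2) \<otimes> x 3 (t 3) \<otimes> x 4 (t 4) \<otimes> x 5 (t 5) \<otimes> x 6 (t 6) \<otimes>
            x 7 (t 7) \<otimes> x 8 (t 8) \<otimes> x 9 (t 9) \<otimes> x 10 (t 10) \<otimes> x 11 (t 11) \<otimes> x 12 (t 12)"

definition triality_perm :: "nat \<Rightarrow> nat"
  where "triality_perm =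
    cycle_of_list [2, 3, 4] \<circ> cycle_of_list [5, 6, 7] \<circ> cycle_of_list [8, 9, 10]"

locale UD4_triality = UD4 G x
  for G :: "('a, 'b) monoid_scheme" (structure) and x :: "nat \<Rightarrow> 'k::field \<Rightarrow> 'a" +
  fixes q :: nat and \<sigma> :: "'a \<Rightarrow> 'a"
  assumes \<sigma>_iso: "\<sigma> \<in> iso G G"
    and \<sigma>_x: "i \<in> {1..12} \<Longrightarrow> \<sigma> (x i t) = x (triality_perm i) (t ^ q)"


text \<open>
  The hypotheses of the two locales are satisfiable: for every finite field with
  \<^term>\<open>q ^ 3\<close> elements there is a model whose elements are the coordinate tuples of the products
  \<open>x 1 a1 \<otimes> \<dots> \<otimes> x 12 a12\<close>, with the multiplication obtained by collecting with the
  commutator relations.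
\<close>

type_synonym 'k d4_tuple =
  "'k \<times> 'k \<times> 'k \<times> 'k \<times> 'k \<times> 'k \<times> 'k \<times> 'k \<times> 'k \<times> 'k \<times> 'k \<times> 'k"

fun d4_mult :: "'k d4_tuple \<Rightarrow> 'k d4_tuple \<Rightarrow> 'k::comm_ring_1 d4_tuple"
  where "d4_mult
      (a1, a2, a3, a4, a5, a6, a7, a8, a9, a10, a11, a12)
      (b1, b2, b3, b4, b5, b6, b7, b8, b9, b10, b11, b12) =
     (a1 + b1,
      a2 + b2,
      a3 + b3,
      a4 + b4,
      a5 + b5 - a2 * b1,
      a6 + b6 - a3 * b1,
      a7 + b7 - a4 * b1,
      a8 + b8 - a5 * b3 - a6 * b2 + a2 * a3 * b1 + a2 * b1 * b3 + a3 * b1 * b2,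
      a9 + b9 - a6 * b4 - a7 * b3 + a3 * a4 * b1 + a3 * b1 * b4 + a4 * b1 * b3,
      a10 + b10 - a5 * b4 - a7 * b2 + a2 * a4 * b1 + a2 * b1 * b4 + a4 * b1 * b2,
      a11 + b11 - a10 * b3 - a8 * b4 - a9 * b2 + a5 * b3 * b4 + a6 * b2 * b4 + a7 * b2 * b3
       - a2 * a3 * a4 * b1 - a2 * a3 * b1 * b4 - a2 * a4 * b1 * b3 - a2 * b1 * b3 * b4 - a3 * a4 * b1 * b2
       - a3 * b1 * b2 * b4 - a4 * b1 * b2 * b3,
      a12 + b12 - a10 * b6 - a11 * b1 - a8 * b7 - a9 * b5 + a5 * a6 * b4 + a5 * a7 * b3 + a5 * b3 * b7
       + a5 * b4 * b6 + a6 * a7 * b2 + a6 * b2 * b7 + a6 * b4 * b5 + a7 * b2 * b6 + a7 * b3 * b5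
       - a2 * a3 * a7 * b1 - a2 * a3 * b1 * b7 - a2 * a4 * a6 * b1 - a2 * a4 * b1 * b6 - a2 * a6 * b1 * b4
       - a2 * a7 * b1 * b3 - a2 * b1 * b3 * b7 - a2 * b1 * b4 * b6 - a3 * a4 * a5 * b1 - a3 * a4 * b1 * b5
       - a3 * a5 * b1 * b4 - a3 * a7 * b1 * b2 - a3 * b1 * b2 * b7 - a3 * b1 * b4 * b5 - a4 * a5 * b1 * b3
       - a4 * a6 * b1 * b2 - a4 * b1 * b2 * b6 - a4 * b1 * b3 * b5 + 2 * a2 * a3 * a4 * b1 * b1
       + a2 * a3 * b1 * b1 * b4 + a2 * a4 * b1 * b1 * b3 + a3 * a4 * b1 * b1 * b2)"

fun d4_inv :: "'k d4_tuple \<Rightarrow> 'k::comm_ring_1 d4_tuple"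
  where "d4_inv (a1, a2, a3, a4, a5, a6, a7, a8, a9, a10, a11, a12) =
     (- a1,
      - a2,
      - a3,
      - a4,
      - a5 - a1 * a2,
      - a6 - a1 * a3,
      - a7 - a1 * a4,
      - a8 - a2 * a6 - a3 * a5 - a1 * a2 * a3,
      - a9 - a3 * a7 - a4 * a6 - a1 * a3 * a4,
      - a10 - a2 * a7 - a4 * a5 - a1 * a2 * a4,
      - a11 - a10 * a3 - a2 * a9 - a4 * a8 - a2 * a3 * a7 - a2 * a4 * a6 - a3 * a4 * a5 - a1 * a2 * a3 * a4,
      - a12 - a1 * a11 - a10 * a6 - a5 * a9 - a7 * a8 - a1 * a10 * a3 - a1 * a2 * a9 - a1 * a4 * a8
       - a2 * a6 * a7 - a3 * a5 * a7 - a4 * a5 * a6 - 2 * a1 * a2 * a3 * a7 - 2 * a1 * a2 * a4 * a6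
       - 2 * a1 * a3 * a4 * a5 - 2 * a1 * a1 * a2 * a3 * a4)"

definition d4_group :: "'k::comm_ring_1 d4_tuple monoid"
  where "d4_group = \<lparr>carrier = UNIV, monoid.mult = d4_mult,
    one = (0, 0, 0, 0, 0, 0, 0, 0, 0, 0, 0, 0)\<rparr>"

definition d4_root_elem :: "nat \<Rightarrow> 'k \<Rightarrow> 'k::comm_ring_1 d4_tuple"
  where "d4_root_elem i t =
    (if i = 1 then t else 0, if i = 2 then t else 0, if i = 3 then t else 0,
     if i = 4 then t else 0, if i = 5 then t else 0, if i = 6 then t else 0,
     if i = 7 then t else 0, if i = 8 then t else 0, if i = 9 then t else 0,
     if i = 10 then t else 0, if i = 11 then t else 0, if i = 12 then t else 0)"

fun d4_triality :: "nat \<Rightarrow> 'k d4_tuple \<Rightarrow> 'k::comm_ring_1 d4_tuple"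
  where "d4_triality q (a1, a2, a3, a4, a5, a6, a7, a8, a9, a10, a11, a12) =
    (a1 ^ q, a4 ^ q, a2 ^ q, a3 ^ q, a7 ^ q, a5 ^ q, a6 ^ q, a10 ^ q, a8 ^ q, a9 ^ q, a11 ^ q, a12 ^ q)"

lemma d4_tuple_cases:
  obtains a1 a2 a3 a4 a5 a6 a7 a8 a9 a10 a11 a12
    where "a = (a1, a2, a3, a4, a5, a6, a7, a8, a9, a10, a11, a12)"
  by (metis surj_pair)

lemma d4_assoc: "d4_mult (d4_mult a b) c = d4_mult a (d4_mult b c)"
  by (cases a rule: d4_tuple_cases; cases b rule: d4_tuple_cases; cases c rule: d4_tuple_cases)
     (simp add: algebra_simps)

lemma d4_inv_left: "d4_mult (d4_inv a) a = (0, 0, 0, 0, 0, 0, 0, 0, 0, 0, 0, 0)"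
  by (cases a rule: d4_tuple_cases) (simp add: algebra_simps)

lemma group_d4_group: "group (d4_group :: 'k::comm_ring_1 d4_tuple monoid)"
proof (rule groupI)
  fix a :: "'k d4_tuple" assume "a \<in> carrier d4_group"
  show "\<exists>b\<in>carrier d4_group. b \<otimes>\<^bsub>d4_group\<^esub> a = \<one>\<^bsub>d4_group\<^esub>"
    by (rule bexI[of _ "d4_inv a"]) (simp_all add: d4_group_def d4_inv_left)
  show "\<one>\<^bsub>d4_group\<^esub> \<otimes>\<^bsub>d4_group\<^esub> a = a"
    by (cases a rule: d4_tuple_cases) (simp add: d4_group_def)
qed (simp_all add: d4_group_def d4_assoc)

lemma (in group) commutator_eqI:
  assumes "g \<in> carrier G" "h \<in> carrier G" "c \<in> carrier G" "g \<otimes> h = h \<otimes> g \<otimes> c"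
  shows "commutator G g h = c"
proof -
  have "commutator G g h = inv (h \<otimes> g) \<otimes> (g \<otimes> h)"
    unfolding commutator_def using assms(1,2) by (simp add: inv_mult_group m_assoc)
  also have "\<dots> = c"
    unfolding assms(4) using assms(1-3) by (simp add: m_assoc inv_solve_left')
  finally show ?thesis .
qed

lemma d4_root_elem_simps:
  "d4_root_elem 1 t = (t, 0, 0, 0, 0, 0, 0, 0, 0, 0, 0, 0)"
  "d4_root_elem 2 t = (0, t, 0, 0, 0, 0, 0, 0, 0, 0, 0, 0)"
  "d4_root_elem 3 t = (0, 0, t, 0, 0, 0, 0, 0, 0, 0, 0, 0)"
  "d4_root_elem 4 t = (0, 0, 0, t, 0, 0, 0, 0, 0, 0, 0, 0)"
  "d4_root_elem 5 t = (0, 0, 0, 0, t, 0, 0, 0, 0, 0, 0, 0)"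
  "d4_root_elem 6 t = (0, 0, 0, 0, 0, t, 0, 0, 0, 0, 0, 0)"
  "d4_root_elem 7 t = (0, 0, 0, 0, 0, 0, t, 0, 0, 0, 0, 0)"
  "d4_root_elem 8 t = (0, 0, 0, 0, 0, 0, 0, t, 0, 0, 0, 0)"
  "d4_root_elem 9 t = (0, 0, 0, 0, 0, 0, 0, 0, t, 0, 0, 0)"
  "d4_root_elem 10 t = (0, 0, 0, 0, 0, 0, 0, 0, 0, t, 0, 0)"
  "d4_root_elem 11 t = (0, 0, 0, 0, 0, 0, 0, 0, 0, 0, t, 0)"
  "d4_root_elem 12 t = (0, 0, 0, 0, 0, 0, 0, 0, 0, 0, 0, t)"
  by (simp_all add: d4_root_elem_def)

lemma UD4_d4_group: "UD4 d4_group (d4_root_elem :: nat \<Rightarrow> 'k::field \<Rightarrow> 'k d4_tuple)"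
proof -
  interpret group "d4_group :: 'k d4_tuple monoid" by (rule group_d4_group)
  have range12: "i \<in> {1..12} \<longleftrightarrow> i \<in> set [1, 2, 3, 4, 5, 6, 7, 8, 9, 10, 11, 12]" for i :: nat
    by auto presburger
  have additive: "\<forall>i\<in>set [1, 2, 3, 4, 5, 6, 7, 8, 9, 10, 11, 12].
      d4_mult (d4_root_elem i t) (d4_root_elem i u) = d4_root_elem i (t + u)" for t u :: 'k
    by (simp add: d4_root_elem_simps del: One_nat_def)
  have relation: "\<forall>(i, j, k)\<in>D4_triples. d4_mult (d4_root_elem i t) (d4_root_elem j u) =
      d4_mult (d4_mult (d4_root_elem j u) (d4_root_elem i t)) (d4_root_elem k (t * u))"
    for t u :: 'k
    by (simp add: D4_triples_def d4_root_elem_simps mult.commute del: One_nat_def)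
  have commute: "\<forall>i\<in>set [1, 2, 3, 4, 5, 6, 7, 8, 9, 10, 11, 12].
      \<forall>j\<in>set [1, 2, 3, 4, 5, 6, 7, 8, 9, 10, 11, 12].
      (\<forall>k. (i, j, k) \<notin> D4_triples \<and> (j, i, k) \<notin> D4_triples) \<longrightarrow>
      d4_mult (d4_root_elem i t) (d4_root_elem j u) =
      d4_mult (d4_root_elem j u) (d4_root_elem i t)" for t u :: 'k
    by (simp add: D4_triples_def d4_root_elem_simps cong: imp_cong del: One_nat_def)
  show ?thesis
  proof
    fix i j k :: nat and t u :: 'k
    show "d4_root_elem i t \<in> carrier d4_group" if "i \<in> {1..12}"
      by (simp add: d4_group_def)
    show "d4_root_elem i t \<otimes>\<^bsub>d4_group\<^esub> d4_root_elem i u = d4_root_elem i (t + u)"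
      if "i \<in> {1..12}"
      using bspec[OF additive, of i t u] that unfolding range12 by (simp add: d4_group_def)
    show "commutator d4_group (d4_root_elem i t) (d4_root_elem j u) = d4_root_elem k (t * u)"
      if "(i, j, k) \<in> D4_triples"
      by (rule commutator_eqI) (use bspec[OF relation that, of t u] in \<open>simp_all add: d4_group_def\<close>)
    show "commutator d4_group (d4_root_elem i t) (d4_root_elem j u) = \<one>\<^bsub>d4_group\<^esub>"
      if "i \<in> {1..12}" "j \<in> {1..12}"
        "\<And>k. (i, j, k) \<notin> D4_triples \<and> (j, i, k) \<notin> D4_triples"
    proof (rule commutator_eqI)
      have "d4_mult (d4_root_elem i t) (d4_root_elem j u) =
        d4_mult (d4_root_elem j u) (d4_root_elem i t)"
        using commute that unfolding range12 by blast
      then show "d4_root_elem i t \<otimes>\<^bsub>d4_group\<^esub> d4_root_elem j u =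
        d4_root_elem j u \<otimes>\<^bsub>d4_group\<^esub> d4_root_elem i t \<otimes>\<^bsub>d4_group\<^esub> \<one>\<^bsub>d4_group\<^esub>"
        using r_one[of "d4_mult (d4_root_elem j u) (d4_root_elem i t)"]
        by (simp add: d4_group_def)
    qed (simp_all add: d4_group_def)
  next
    fix g :: "'k d4_tuple" assume "g \<in> carrier d4_group"
    obtain a1 a2 a3 a4 a5 a6 a7 a8 a9 a10 a11 a12 where
      g: "g = (a1, a2, a3, a4, a5, a6, a7, a8, a9, a10, a11, a12)"
      by (cases g rule: d4_tuple_cases)
    have product: "d4_root_elem 1 (t 1) \<otimes>\<^bsub>d4_group\<^esub> d4_root_elem 2 (t 2) \<otimes>\<^bsub>d4_group\<^esub>
      d4_root_elem 3 (t 3) \<otimes>\<^bsub>d4_group\<^esub> d4_root_elem 4 (t 4) \<otimes>\<^bsub>d4_group\<^esub>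
      d4_root_elem 5 (t 5) \<otimes>\<^bsub>d4_group\<^esub> d4_root_elem 6 (t 6) \<otimes>\<^bsub>d4_group\<^esub>
      d4_root_elem 7 (t 7) \<otimes>\<^bsub>d4_group\<^esub> d4_root_elem 8 (t 8) \<otimes>\<^bsub>d4_group\<^esub>
      d4_root_elem 9 (t 9) \<otimes>\<^bsub>d4_group\<^esub> d4_root_elem 10 (t 10) \<otimes>\<^bsub>d4_group\<^esub>
      d4_root_elem 11 (t 11) \<otimes>\<^bsub>d4_group\<^esub> d4_root_elem 12 (t 12) =
      (t 1, t 2, t 3, t 4, t 5, t 6, t 7, t 8, t 9, t 10, t 11, t 12)" for t :: "nat \<Rightarrow> 'k"
      by (simp add: d4_group_def d4_root_elem_simps del: One_nat_def)
    define c where "c = (\<lambda>i\<in>{1..12}.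
      [a1, a2, a3, a4, a5, a6, a7, a8, a9, a10, a11, a12] ! (i - 1))"
    show "\<exists>!t. t \<in> {1..12::nat} \<rightarrow>\<^sub>E UNIV \<and> g =
      d4_root_elem 1 (t 1) \<otimes>\<^bsub>d4_group\<^esub> d4_root_elem 2 (t 2) \<otimes>\<^bsub>d4_group\<^esub>
      d4_root_elem 3 (t 3) \<otimes>\<^bsub>d4_group\<^esub> d4_root_elem 4 (t 4) \<otimes>\<^bsub>d4_group\<^esub>
      d4_root_elem 5 (t 5) \<otimes>\<^bsub>d4_group\<^esub> d4_root_elem 6 (t 6) \<otimes>\<^bsub>d4_group\<^esub>
      d4_root_elem 7 (t 7) \<otimes>\<^bsub>d4_group\<^esub> d4_root_elem 8 (t 8) \<otimes>\<^bsub>d4_group\<^esub>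
      d4_root_elem 9 (t 9) \<otimes>\<^bsub>d4_group\<^esub> d4_root_elem 10 (t 10) \<otimes>\<^bsub>d4_group\<^esub>
      d4_root_elem 11 (t 11) \<otimes>\<^bsub>d4_group\<^esub> d4_root_elem 12 (t 12)"
      unfolding product g
    proof (rule ex1I[of _ c])
      show "c \<in> {1..12} \<rightarrow>\<^sub>E UNIV \<and> (a1, a2, a3, a4, a5, a6, a7, a8, a9, a10, a11, a12) =
        (c 1, c 2, c 3, c 4, c 5, c 6, c 7, c 8, c 9, c 10, c 11, c 12)"
        by (simp add: c_def PiE_def)
    next
      fix t :: "nat \<Rightarrow> 'k"
      assume t: "t \<in> {1..12} \<rightarrow>\<^sub>E UNIV \<and> (a1, a2, a3, a4, a5, a6, a7, a8, a9, a10, a11, a12) =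
        (t 1, t 2, t 3, t 4, t 5, t 6, t 7, t 8, t 9, t 10, t 11, t 12)"
      have "t i = c i" if i: "i \<in> {1..12}" for i
      proof -
        have "c i = [t 1, t 2, t 3, t 4, t 5, t 6, t 7, t 8, t 9, t 10, t 11, t 12] ! (i - 1)"
          using t i by (simp add: c_def)
        also have "\<dots> = t i"
          using i unfolding range12 by auto
        finally show ?thesis by simp
      qed
      moreover have "t i = c i" if "i \<notin> {1..12}" for i
      proof -
        have "t i = undefined"
          by (rule PiE_arb[OF conjunct1[OF t] that])
        then show ?thesis
          using that unfolding c_def restrict_def by argo
      qed
      ultimately show "t = c" by blast
    qed
  qed
qed

lemma triality_perm_simps:
  "triality_perm 1 = 1" "triality_perm 2 = 3" "triality_perm 3 = 4" "triality_perm 4 = 2"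
  "triality_perm 5 = 6" "triality_perm 6 = 7" "triality_perm 7 = 5"
  "triality_perm 8 = 9" "triality_perm 9 = 10" "triality_perm 10 = 8"
  "triality_perm 11 = 11" "triality_perm 12 = 12"
  by (simp_all add: triality_perm_def transpose_def)

lemma UD4_triality_exists:
  assumes "prime p" "q = p ^ m" "card (UNIV :: 'k::finite_field set) = q ^ 3"
  shows "UD4_triality d4_group (d4_root_elem :: nat \<Rightarrow> 'k \<Rightarrow> 'k d4_tuple) q (d4_triality q)"
proof -
  have prime_char: "prime CHAR('k)"
    by (simp add: prime_CHAR_semidom finite_imp_CHAR_pos)
  have "CHAR('k) dvd p ^ (m * 3)"
    using CHAR_dvd_CARD[where 'a = 'k] assms(2,3) by (simp add: power_mult)
  then have char: "CHAR('k) = p"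
    using prime_char \<open>prime p\<close> by (meson prime_dvd_power primes_dvd_imp_eq)
  have q_pos: "q > 0"
    using assms(1,2) by (simp add: prime_gt_0_nat)
  have add: "(s + t) ^ q = s ^ q + t ^ q" for s t :: 'k
    by (rule freshmans_dream'[OF prime_char]) (simp add: char assms(2))
  have neg: "(- t) ^ q = - (t ^ q)" for t :: 'k
    using add[of "- t" t] q_pos by (simp add: eq_neg_iff_add_eq_0 power_0_left)
  have diff: "(s - t) ^ q = s ^ q - t ^ q" for s t :: 'k
    using add[of s "- t"] by (simp add: neg)
  have two: "2 ^ q = (2 :: 'k)"
    using add[of 1 1] by simp
  have "inj (\<lambda>t :: 'k. t ^ q)"
  proof (rule injI)
    fix s t :: 'k assume "s ^ q = t ^ q"
    then have "(s - t) ^ q = 0" by (simp add: diff)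
    then show "s = t" by simp
  qed
  then have "inj (d4_triality q :: 'k d4_tuple \<Rightarrow> _)"
    unfolding inj_def by clarsimp
  then have "bij (d4_triality q :: 'k d4_tuple \<Rightarrow> _)"
    by (simp add: bij_def finite_UNIV_inj_surj)
  moreover have "d4_triality q (d4_mult a b) = d4_mult (d4_triality q a) (d4_triality q b)"
    for a b :: "'k d4_tuple"
    by (cases a rule: d4_tuple_cases; cases b rule: d4_tuple_cases)
         (simp add: add diff two power_mult_distrib)
  ultimately have "d4_triality q \<in> iso d4_group (d4_group :: 'k d4_tuple monoid)"
    by (simp add: iso_def hom_def d4_group_def del: split_paired_All)
  moreover have "d4_triality q (d4_root_elem i t) = d4_root_elem (triality_perm i) (t ^ q)"
    if "i \<in> {1..12}" for i and t :: 'k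
  proof -
    have "i \<in> set [1, 2, 3, 4, 5, 6, 7, 8, 9, 10, 11, 12]"
      using that by auto presburger
    then show ?thesis
      using q_pos
      by (auto simp: triality_perm_simps d4_root_elem_simps simp del: One_nat_def)
  qed
  ultimately show ?thesis
    by (intro UD4_triality.intro UD4_d4_group UD4_triality_axioms.intro)
qed

end

theory Submission
  imports Defs "HOL-Computational_Algebra.Polynomial"
begin

text \<open>
  By Burnside's lemma for the conjugation action, \<open>k(U) * |U|\<close> is the number of commuting pairs
  of \<open>U\<close>, and \<open>|U| = q ^ 12\<close>; so the commuting pairs are counted.

  Let \<open>K\<close> be the field with \<open>q ^ 3\<close> elements and \<open>F\<close> the fixed field of \<open>\<phi> t = t ^ q\<close>. The
  fixed points of triality are the products with coordinates \<open>(a, t, u, w, c, d)\<close>, where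
  \<open>a, c, d\<close> in \<open>F\<close> belong to the roots 1, 11, 12 and \<open>t, u, w\<close> in \<open>K\<close> to the orbits \<open>{2, 3, 4}\<close>,
  \<open>{5, 6, 7}\<close>, \<open>{8, 9, 10}\<close>. The product of two elements is given by polynomials in the coordinates
  that are built from the trace, the norm and the quadratic map \<open>adj x = \<phi> x * \<phi> (\<phi> x)\<close> with
  its polarisation \<open>cross\<close>. The elements with \<open>t = 0\<close> form a Heisenberg group of order
  \<open>q ^ 9\<close>, whose centre is the coordinate \<open>d\<close>. The scalings \<open>t \<mapsto> k t\<close>, \<open>k \<noteq> 0\<close>, extend to
  automorphisms, so that a nonzero \<open>t\<close> may be taken to be 1 (\<open>card_commuting_pairs\<close>).

  For fixed \<open>g\<close>, commuting with \<open>g\<close> is a system of equations for the coordinates of the other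
  element, which can be solved one coordinate after the other.

  \<^item> Let \<open>h\<close> have \<open>t = 0\<close>. If the commutator of \<open>g\<close> and \<open>h\<close> is central, it vanishes if and only if \<open>g\<close>
    satisfies an affine equation, whose linear part is a nondegenerate symplectic form on
    \<open>(a, u, w, c)\<close>. The equation is vacuous if \<open>h\<close> is central, and otherwise it divides the number
    of solutions by \<open>q\<close> (\<open>card_pairs_Heisenberg\<close>).

  \<^item> Let \<open>g\<close> have \<open>t = 1\<close>. If \<open>a \<noteq> 0\<close>, then the coordinates \<open>a'\<close> and \<open>c'\<close> of the other element
    are determined by the remaining ones (\<open>card_centraliser_generic\<close>). If \<open>a = 0\<close>, the last two
    coordinates of the commutator prescribe the traces of \<open>w'\<close> and \<open>u * w'\<close>: these are independent
    conditions on \<open>w'\<close> if \<open>u\<close> is not in \<open>F\<close> (\<open>card_centraliser_regular\<close>), and otherwise there is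
    one condition on \<open>w'\<close> and one compatibility condition (\<open>card_centraliser_singular\<close>).

  The parity of \<open>q\<close> matters because \<open>u'\<close> always has to be found from an equation
  \<open>Tr u' - u' = r\<close>. Its solutions are \<open>u' = y - r\<close> with \<open>y\<close> in \<open>F\<close> and \<open>2 * y = Tr r\<close>: there is
  exactly one if \<open>q\<close> is odd, while for even \<open>q\<close> there are \<open>q\<close> or none.
\<close>

section \<open>Conjugacy classes and commuting pairs\<close>

text \<open>
  For conjugation, the elements fixed by \<open>g\<close> are those that commute with \<open>g\<close>, so this is Burnside's
  lemma.
\<close>

lemma (in group) class_number_times_order:
  assumes "finite (carrier G)"
  shows "class_number G * Coset.order G =
    card {(g, h). g \<in> carrier G \<and> h \<in> carrier G \<and> g \<otimes> h = h \<otimes> g}"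
proof -
  let ?\<phi> = "\<lambda>g. \<lambda>h\<in>carrier G. g \<otimes> h \<otimes> inv g"
  interpret conj: group_action G "carrier G" ?\<phi>
    by (rule action_by_conjugation)
  have inv: "invariants (carrier G) ?\<phi> g = {h \<in> carrier G. g \<otimes> h = h \<otimes> g}"
    if "g \<in> carrier G" for g
    using that by (auto simp: invariants_def inv_solve_right')
  have "class_number G * Coset.order G = (\<Sum>g\<in>carrier G. card {h \<in> carrier G. g \<otimes> h = h \<otimes> g})"
    using conj.burnside assms by (simp add: class_number_def inv)
  also have "\<dots> = card (SIGMA g:carrier G. {h \<in> carrier G. g \<otimes> h = h \<otimes> g})"
    using assms by simp
  also have "(SIGMA g:carrier G. {h \<in> carrier G. g \<otimes> h = h \<otimes> g}) =
    {(g, h). g \<in> carrier G \<and> h \<in> carrier G \<and> g \<otimes> h = h \<otimes> g}"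
    by auto
  finally show ?thesis .
qed

text \<open>
  It allows to count commuting pairs of coordinate tuples instead of group elements: as \<open>f\<close> is
  injective on its whole type, \<open>f (mul a b) = f (mul b a)\<close> means \<open>mul a b = mul b a\<close>.
\<close>

lemma (in group) class_number_coordinates:
  fixes f :: "'c \<Rightarrow> 'a"
  assumes "inj f" "carrier G = f ` A" "finite A"
    and mult: "\<And>a b. a \<in> A \<Longrightarrow> b \<in> A \<Longrightarrow> f a \<otimes> f b = f (mul a b)"
  shows "class_number G * card A = card {(a, b). a \<in> A \<and> b \<in> A \<and> mul a b = mul b a}"
proof -
  have "{(g, h). g \<in> carrier G \<and> h \<in> carrier G \<and> g \<otimes> h = h \<otimes> g} =
    map_prod f f ` {(a, b). a \<in> A \<and> b \<in> A \<and> mul a b = mul b a}"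
    unfolding assms(2) using inj_eq[OF assms(1)] by (force simp: mult)
  moreover have "inj_on (map_prod f f) {(a, b). a \<in> A \<and> b \<in> A \<and> mul a b = mul b a}"
    using prod.inj_map[OF assms(1,1)] by (rule inj_on_subset) simp
  moreover have "Coset.order G = card A"
    unfolding Coset.order_def assms(2) using assms(1) by (intro card_image) (rule inj_on_subset, auto)
  ultimately show ?thesis
    using class_number_times_order assms(2,3) by (simp add: card_image)
qed

lemma (in group) group_fixed_subgroup:
  assumes "\<sigma> \<in> iso G G"
  shows "group (fixed_subgroup G \<sigma>)"
proof -
  interpret \<sigma>: group_hom G G \<sigma>
    using assms by (auto simp: iso_def group_hom_def group_hom_axioms_def is_group)
  have "subgroup {g \<in> carrier G. \<sigma> g = g} G"
    by (rule subgroupI) (auto intro: exI[of _ \<one>])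
  then show ?thesis
    unfolding fixed_subgroup_def by (rule subgroup.subgroup_is_group) (rule is_group)
qed

section \<open>Counting by fibres\<close>

lemma card_fibre_sum:
  fixes P :: "'a::finite \<Rightarrow> 'b::finite \<Rightarrow> bool"
  shows "card {(x, y). P x y} = (\<Sum>x\<in>UNIV. card {y. P x y})"
proof -
  have "{(x, y). P x y} = (SIGMA x:UNIV. {y. P x y})"
    by auto
  then show ?thesis
    by simp
qed

text \<open>
  The tool for most of the counts below. Solution sets are written with left-nested tuples
  \<open>((\<dots>, x), y)\<close>, and the last coordinate is split off as long as the number of its values does not
  depend on the others.
\<close>

lemma card_fibres:
  fixes P :: "'a::finite \<Rightarrow> 'b::finite \<Rightarrow> bool"
  assumes "\<And>x. R x \<Longrightarrow> card {y. P x y} = k" "\<And>x y. P x y \<Longrightarrow> R x"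
  shows "card {(x, y). P x y} = card {x. R x} * k"
proof -
  have "card {y. P x y} = (if R x then k else 0)" for x
    using assms by auto
  then show ?thesis
    by (simp add: card_fibre_sum sum.If_cases)
qed

text \<open>
  The pigeonhole principle in the form that turns upper bounds, such as the degree of a polynomial
  for its number of roots, into exact fibre cardinalities.
\<close>

lemma card_fibres_maximal:
  assumes "finite A" "finite B" "f ` A \<subseteq> B"
    and fibre: "\<And>b. b \<in> B \<Longrightarrow> card {a \<in> A. f a = b} \<le> k"
    and "card A = n * k" "card B \<le> n" "k > 0"
  shows "card B = n" "b \<in> B \<Longrightarrow> card {a \<in> A. f a = b} = k"
proof -
  have sum: "card A = (\<Sum>b\<in>B. card {a \<in> A. f a = b})"
    using sum_fun_comp[OF assms(1-3), of "\<lambda>_. 1 :: nat"] by simp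
  also have "\<dots> \<le> card B * k"
    using sum_bounded_above[of B "\<lambda>b. card {a \<in> A. f a = b}" k] fibre by simp
  finally show n: "card B = n"
    using assms(5-7) by (simp add: le_antisym)
  show "card {a \<in> A. f a = b} = k" if b: "b \<in> B"
  proof (rule ccontr)
    assume "card {a \<in> A. f a = b} \<noteq> k"
    then have "(\<Sum>b\<in>B. card {a \<in> A. f a = b}) < (\<Sum>b\<in>B. k)"
      using fibre b assms(2) by (intro sum_strict_mono_ex1) (auto simp: le_less)
    then show False
      using sum n assms(5) by simp
  qed
qed

lemma card_Collect_split:
  fixes P :: "'a::finite \<Rightarrow> bool"
  shows "card {x. P x} = card {x. P x \<and> Q x} + card {x. P x \<and> \<not> Q x}"
proof -
  have "{x. P x} = {x. P x \<and> Q x} \<union> {x. P x \<and> \<not> Q x}"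
    by auto
  then show ?thesis
    by (simp add: card_Un_disjoint disjoint_iff)
qed

lemma card_fibres_transfer:
  fixes P :: "'a::finite \<Rightarrow> 'b::finite \<Rightarrow> bool" and Q :: "'a \<Rightarrow> 'c::finite \<Rightarrow> bool"
  assumes "\<And>x. card {y. P x y} = card {z. Q x z} * k"
  shows "card {(x, y). P x y} = card {(x, z). Q x z} * k"
  unfolding card_fibre_sum assms sum_distrib_right ..

text \<open>
  This lemma and the next two are stated for arbitrary types since the proof methods would split
  variables that range over tuples into their components.
\<close>

lemma card_pairs_reindex:
  assumes "bij f" "\<And>g h. R (f g) (f h) \<longleftrightarrow> R' g h"
  shows "card {(g, h). R g h} = card {(g, h). R' g h}"
proof -
  have "bij_betw (map_prod f f) {(g, h). R' g h} {(g, h). R g h}"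
  proof (rule bij_betwI[of _ _ _ "map_prod (inv_into UNIV f) (inv_into UNIV f)"])
    show "map_prod (inv_into UNIV f) (inv_into UNIV f) \<in> {(g, h). R g h} \<rightarrow> {(g, h). R' g h}"
      using assms by (auto simp flip: assms(2) simp: surj_f_inv_f bij_is_surj)
  qed (use assms in \<open>auto simp: bij_is_inj bij_is_surj surj_f_inv_f\<close>)
  then show ?thesis
    by (simp add: bij_betw_same_card)
qed

lemma card_pairs_swap:
  assumes "\<And>g h. R g h \<longleftrightarrow> R' h g"
  shows "card {(g, h). R g h} = card {(g, h). R' g h}"
proof -
  have "{(g, h). R' g h} = prod.swap ` {(g, h). R g h}"
    using assms by auto
  then show ?thesis
    by (simp add: card_image)
qed

lemma card_pairs_fibres:
  fixes R :: "'a::finite \<Rightarrow> 'a \<Rightarrow> bool" and f :: "'a \<Rightarrow> 'b::finite"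
  shows "card {(g, h). R g h} = (\<Sum>s\<in>UNIV. \<Sum>t\<in>UNIV. card {(g, h). R g h \<and> f g = s \<and> f h = t})"
proof -
  have "card {(g, h). R g h} =
    (\<Sum>b\<in>UNIV. card {p \<in> {(g, h). R g h}. map_prod f f p = b})"
    using sum_fun_comp[of "{(g, h). R g h}" UNIV "map_prod f f" "\<lambda>_. 1 :: nat"] by simp
  also have "\<dots> = (\<Sum>b\<in>UNIV. case b of (s, t) \<Rightarrow> card {(g, h). R g h \<and> f g = s \<and> f h = t})"
    by (rule sum.cong) (auto intro!: arg_cong[of _ _ card])
  finally show ?thesis
    by (simp add: sum.cartesian_product flip: UNIV_Times_UNIV)
qed

section \<open>Collection in the unipotent group of type D4\<close>

lemma D4_triples_mem:
  "(1, 2, 5) \<in> D4_triples" "(1, 3, 6) \<in> D4_triples" "(1, 4, 7) \<in> D4_triples"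
  "(1, 11, 12) \<in> D4_triples" "(2, 6, 8) \<in> D4_triples" "(2, 7, 10) \<in> D4_triples"
  "(2, 9, 11) \<in> D4_triples" "(3, 5, 8) \<in> D4_triples" "(3, 7, 9) \<in> D4_triples"
  "(3, 10, 11) \<in> D4_triples" "(4, 5, 10) \<in> D4_triples" "(4, 6, 9) \<in> D4_triples"
  "(4, 8, 11) \<in> D4_triples" "(5, 9, 12) \<in> D4_triples" "(6, 10, 12) \<in> D4_triples"
  "(7, 8, 12) \<in> D4_triples"
  by (simp_all add: D4_triples_def del: One_nat_def)

text \<open>
  The pairs \<open>i < j\<close> of roots whose sum is not a root.
\<close>

definition D4_commuting :: "(nat \<times> nat) set"
  where "D4_commuting =
    {(i, j). 1 \<le> i \<and> i < j \<and> j \<le> 12 \<and> (\<forall>k. (i, j, k) \<notin> D4_triples)}"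

text \<open>
  With \<open>D4_triples_mem\<close> these facts cover all pairs \<open>i < j\<close>; composed with the lemmas on collection
  they become rewrite rules, one for every pair of root subgroups in the wrong order.
\<close>

lemma D4_commuting_mem:
  "(1, 5) \<in> D4_commuting" "(1, 6) \<in> D4_commuting" "(1, 7) \<in> D4_commuting" "(1, 8) \<in> D4_commuting"
  "(1, 9) \<in> D4_commuting" "(1, 10) \<in> D4_commuting" "(1, 12) \<in> D4_commuting" "(2, 3) \<in> D4_commuting"
  "(2, 4) \<in> D4_commuting" "(2, 5) \<in> D4_commuting" "(2, 8) \<in> D4_commuting" "(2, 10) \<in> D4_commuting"
  "(2, 11) \<in> D4_commuting" "(2, 12) \<in> D4_commuting" "(3, 4) \<in> D4_commuting" "(3, 6) \<in> D4_commuting"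
  "(3, 8) \<in> D4_commuting" "(3, 9) \<in> D4_commuting" "(3, 11) \<in> D4_commuting" "(3, 12) \<in> D4_commuting"
  "(4, 7) \<in> D4_commuting" "(4, 9) \<in> D4_commuting" "(4, 10) \<in> D4_commuting" "(4, 11) \<in> D4_commuting"
  "(4, 12) \<in> D4_commuting" "(5, 6) \<in> D4_commuting" "(5, 7) \<in> D4_commuting" "(5, 8) \<in> D4_commuting"
  "(5, 10) \<in> D4_commuting" "(5, 11) \<in> D4_commuting" "(5, 12) \<in> D4_commuting" "(6, 7) \<in> D4_commuting"
  "(6, 8) \<in> D4_commuting" "(6, 9) \<in> D4_commuting" "(6, 11) \<in> D4_commuting" "(6, 12) \<in> D4_commuting"
  "(7, 9) \<in> D4_commuting" "(7, 10) \<in> D4_commuting" "(7, 11) \<in> D4_commuting" "(7, 12) \<in> D4_commuting"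
  "(8, 9) \<in> D4_commuting" "(8, 10) \<in> D4_commuting" "(8, 11) \<in> D4_commuting" "(8, 12) \<in> D4_commuting"
  "(9, 10) \<in> D4_commuting" "(9, 11) \<in> D4_commuting" "(9, 12) \<in> D4_commuting" "(10, 11) \<in> D4_commuting"
  "(10, 12) \<in> D4_commuting" "(11, 12) \<in> D4_commuting"
  by (simp_all add: D4_commuting_def D4_triples_def del: One_nat_def)

text \<open>
  The coordinates as an extensional function on \<open>{1..12}\<close>, the form in which the axiom on unique
  products speaks of them.
\<close>

fun d4_coords :: "'k d4_tuple \<Rightarrow> nat \<Rightarrow> 'k"
  where "d4_coords (a1, a2, a3, a4, a5, a6, a7, a8, a9, a10, a11, a12) =
    (\<lambda>i\<in>{1..12}. [a1, a2, a3, a4, a5, a6, a7, a8, a9, a10, a11, a12] ! (i - 1))"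

lemma d4_coords_extensional: "d4_coords a \<in> {1..12} \<rightarrow>\<^sub>E UNIV"
  by (cases a rule: d4_tuple_cases) simp

lemma inj_d4_coords: "inj d4_coords"
proof (rule injI)
  fix a b :: "'k d4_tuple" assume "d4_coords a = d4_coords b"
  then have eq: "\<forall>i\<in>{1, 2, 3, 4, 5, 6, 7, 8, 9, 10, 11, 12}. d4_coords a i = d4_coords b i"
    by simp
  show "a = b"
    using eq by (cases a rule: d4_tuple_cases; cases b rule: d4_tuple_cases) simp
qed

context UD4
begin

text \<open>
  The product is bracketed to the right because this is the normal form of the collection rules.
\<close>

fun root_product :: "'k d4_tuple \<Rightarrow> 'a"
  where "root_product (a1, a2, a3, a4, a5, a6, a7, a8, a9, a10, a11, a12) =
    x 1 a1 \<otimes> (x 2 a2 \<otimes> (x 3 a3 \<otimes> (x 4 a4 \<otimes> (x 5 a5 \<otimes> (x 6 a6 \<otimes>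
    (x 7 a7 \<otimes> (x 8 a8 \<otimes> (x 9 a9 \<otimes> (x 10 a10 \<otimes> (x 11 a11 \<otimes> x 12 a12))))))))))"

lemma x_closed_numeral:
  "x 1 t \<in> carrier G" "x 2 t \<in> carrier G" "x 3 t \<in> carrier G" "x 4 t \<in> carrier G"
  "x 5 t \<in> carrier G" "x 6 t \<in> carrier G" "x 7 t \<in> carrier G" "x 8 t \<in> carrier G"
  "x 9 t \<in> carrier G" "x 10 t \<in> carrier G" "x 11 t \<in> carrier G" "x 12 t \<in> carrier G"
  by (rule x_closed, simp)+

lemma x_zero: "i \<in> {1..12} \<Longrightarrow> x i 0 = \<one>"
  using x_add[of i 0 0] x_closed[of i 0] by simp

lemma D4_triples_range:
  "(i, j, k) \<in> D4_triples \<Longrightarrow> i \<in> {1..12} \<and> j \<in> {1..12} \<and> k \<in> {1..12} \<and> i < j \<and> j < k"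
  unfolding D4_triples_def by auto

lemma commutator_swap:
  assumes "g \<in> carrier G" "h \<in> carrier G"
  shows "g \<otimes> h = h \<otimes> g \<otimes> commutator G g h"
proof -
  have "h \<otimes> g \<otimes> commutator G g h = h \<otimes> g \<otimes> inv (h \<otimes> g) \<otimes> (g \<otimes> h)"
    unfolding commutator_def using assms by (simp add: inv_mult_group m_assoc)
  then show ?thesis
    using assms by simp
qed

text \<open>
  Factors with small index move to the left. The correction factor belongs to the root
  \<open>k = i + j\<close>, which is higher than both, so that collection terminates.
\<close>

lemma collect:
  assumes "(i, j, k) \<in> D4_triples"
  shows "x j u \<otimes> x i t = x i t \<otimes> (x j u \<otimes> x k (- (t * u)))"
proof -
  have r: "i \<in> {1..12}" "j \<in> {1..12}" "k \<in> {1..12}"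
    using D4_triples_range[OF assms] by auto
  note cl = x_closed[OF r(1)] x_closed[OF r(2)] x_closed[OF r(3)]
  have "x i t \<otimes> x j u = x j u \<otimes> x i t \<otimes> x k (t * u)"
    using commutator_swap[of "x i t" "x j u"] comm_x[OF assms, of t u] cl by simp
  then have "x i t \<otimes> x j u \<otimes> x k (- (t * u)) = x j u \<otimes> x i t \<otimes> (x k (t * u) \<otimes> x k (- (t * u)))"
    using cl by (simp add: m_assoc)
  then show ?thesis
    using cl by (simp add: x_add[OF r(3)] x_zero[OF r(3)] m_assoc)
qed

lemma collect_left:
  assumes "(i, j, k) \<in> D4_triples" "z \<in> carrier G"
  shows "x j u \<otimes> (x i t \<otimes> z) = x i t \<otimes> (x j u \<otimes> (x k (- (t * u)) \<otimes> z))"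
proof -
  have r: "i \<in> {1..12}" "j \<in> {1..12}" "k \<in> {1..12}"
    using D4_triples_range[OF assms(1)] by auto
  note cl = x_closed[OF r(1)] x_closed[OF r(2)] x_closed[OF r(3)]
  show ?thesis
    using collect[OF assms(1), of u t] cl assms(2) by (simp flip: m_assoc)
qed

lemma collect_trivial:
  assumes "(i, j) \<in> D4_commuting"
  shows "x j u \<otimes> x i t = x i t \<otimes> x j u"
proof -
  have ij: "i \<in> {1..12}" "j \<in> {1..12}" "i < j"
    using assms by (auto simp: D4_commuting_def)
  have "commutator G (x i t) (x j u) = \<one>"
  proof (rule comm_x_trivial[OF ij(1,2)])
    fix k
    show "(i, j, k) \<notin> D4_triples \<and> (j, i, k) \<notin> D4_triples"
      using assms D4_triples_range[of j i k] by (auto simp: D4_commuting_def)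
  qed
  then show ?thesis
    using commutator_swap[of "x i t" "x j u"] x_closed ij by simp
qed

lemma collect_trivial_left:
  assumes "(i, j) \<in> D4_commuting" "z \<in> carrier G"
  shows "x j u \<otimes> (x i t \<otimes> z) = x i t \<otimes> (x j u \<otimes> z)"
proof -
  have ij: "i \<in> {1..12}" "j \<in> {1..12}"
    using assms by (auto simp: D4_commuting_def)
  show ?thesis
    using collect_trivial[OF assms(1), of u t] x_closed ij assms(2) by (simp flip: m_assoc)
qed

lemma x_add_left:
  assumes "i \<in> {1..12}" "z \<in> carrier G"
  shows "x i t \<otimes> (x i u \<otimes> z) = x i (t + u) \<otimes> z"
  using x_add[OF assms(1), of t u] x_closed[OF assms(1)] assms(2) by (simp flip: m_assoc)

lemmas collect_rules =
  D4_triples_mem[THEN collect] D4_triples_mem[THEN collect_left]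
  D4_commuting_mem[THEN collect_trivial] D4_commuting_mem[THEN collect_trivial_left]
  x_add x_add_left x_closed_numeral

text \<open>
  Collecting the product of two collected words with the commutator relations leads to the
  polynomials that define \<^const>\<open>d4_mult\<close>. So the relations alone determine the multiplication.
\<close>

lemma root_product_mult: "root_product a \<otimes> root_product b = root_product (d4_mult a b)"
  by (cases a rule: d4_tuple_cases; cases b rule: d4_tuple_cases)
    (simp add: collect_rules m_assoc algebra_simps del: One_nat_def)

lemma root_product_closed: "root_product a \<in> carrier G"
  by (cases a rule: d4_tuple_cases) (simp add: x_closed_numeral del: One_nat_def)

lemma bij_root_product: "bij_betw root_product UNIV (carrier G)"
proof (rule bij_betw_imageI)
  let ?P = "\<lambda>t :: nat \<Rightarrow> 'k. x 1 (t 1) \<otimes> x 2 (t 2) \<otimes> x 3 (t 3) \<otimes> x 4 (t 4) \<otimes> x 5 (t 5) \<otimes> x 6 (t 6) \<otimes>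
    x 7 (t 7) \<otimes> x 8 (t 8) \<otimes> x 9 (t 9) \<otimes> x 10 (t 10) \<otimes> x 11 (t 11) \<otimes> x 12 (t 12)"
  have product: "root_product a = ?P (d4_coords a)" for a
    by (cases a rule: d4_tuple_cases) (simp add: m_assoc x_closed_numeral del: One_nat_def)
  show "inj root_product"
  proof (rule injI)
    fix a b assume eq: "root_product a = root_product b"
    have "d4_coords a = d4_coords b"
      using unique_product[OF root_product_closed[of a]]
    proof (rule ex1E)
      fix t
      assume unique: "\<forall>s. s \<in> {1..12} \<rightarrow>\<^sub>E UNIV \<and> root_product a = ?P s \<longrightarrow> s = t"
      have "d4_coords c = t" if "root_product c = root_product a" for c
        using unique[rule_format, of "d4_coords c"] d4_coords_extensional[of c] product[of c] that
        by argo
      then show "d4_coords a = d4_coords b"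
        using eq by metis
    qed
    then show "a = b"
      by (rule injD[OF inj_d4_coords])
  qed
  show "range root_product = carrier G"
  proof (rule equalityI; rule subsetI)
    fix g assume "g \<in> range root_product"
    then show "g \<in> carrier G"
      using root_product_closed by blast
  next
    fix g assume "g \<in> carrier G"
    from ex1_implies_ex[OF unique_product[OF this]] obtain t where t: "g = ?P t"
      by (elim exE conjE)
    have "g = root_product (t 1, t 2, t 3, t 4, t 5, t 6, t 7, t 8, t 9, t 10, t 11, t 12)"
      unfolding t by (simp add: m_assoc x_closed_numeral del: One_nat_def)
    then show "g \<in> range root_product"
      by (rule range_eqI)
  qed
qed

end

context UD4_triality
begin

text \<open>
  On collected words, \<open>\<sigma>\<close> permutes the factors only inside the blocks \<open>{2, 3, 4}\<close>, \<open>{5, 6, 7}\<close> and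
  \<open>{8, 9, 10}\<close>, whose root subgroups commute.
\<close>

lemma \<sigma>_root_product: "\<sigma> (root_product a) = root_product (d4_triality q a)"
proof -
  interpret \<sigma>: group_hom G G \<sigma>
    using \<sigma>_iso by (auto simp: iso_def group_hom_def group_hom_axioms_def is_group)
  have \<sigma>_numeral: "\<sigma> (x 1 t) = x 1 (t ^ q)" "\<sigma> (x 2 t) = x 3 (t ^ q)" "\<sigma> (x 3 t) = x 4 (t ^ q)"
    "\<sigma> (x 4 t) = x 2 (t ^ q)" "\<sigma> (x 5 t) = x 6 (t ^ q)" "\<sigma> (x 6 t) = x 7 (t ^ q)"
    "\<sigma> (x 7 t) = x 5 (t ^ q)" "\<sigma> (x 8 t) = x 9 (t ^ q)" "\<sigma> (x 9 t) = x 10 (t ^ q)"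
    "\<sigma> (x 10 t) = x 8 (t ^ q)" "\<sigma> (x 11 t) = x 11 (t ^ q)" "\<sigma> (x 12 t) = x 12 (t ^ q)" for t
    by (subst \<sigma>_x, simp, subst triality_perm_simps, rule refl)+
  show ?thesis
    by (cases a rule: d4_tuple_cases)
      (simp add: \<sigma>_numeral collect_rules m_assoc del: One_nat_def)
qed

lemma carrier_fixed_subgroup:
  "carrier (fixed_subgroup G \<sigma>) = root_product ` {a. d4_triality q a = a}"
proof -
  have inj: "inj root_product"
    using bij_root_product by (rule bij_betw_imp_inj_on)
  have "carrier (fixed_subgroup G \<sigma>) = {g \<in> root_product ` UNIV. \<sigma> g = g}"
    unfolding fixed_subgroup_def bij_betw_imp_surj_on[OF bij_root_product] by simp
  also have "\<dots> = root_product ` {a. \<sigma> (root_product a) = root_product a}"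
    by blast
  also have "{a. \<sigma> (root_product a) = root_product a} = {a. d4_triality q a = a}"
    unfolding \<sigma>_root_product inj_eq[OF inj] by (rule refl)
  finally show ?thesis .
qed

end

section \<open>Cubic extensions of finite fields\<close>

text \<open>
  The type \<open>'k\<close> is the cubic extension \<open>K\<close> of the field \<open>F\<close> with \<open>q\<close> elements, and \<open>\<phi>\<close> generates its Galois
  group. Having a name of its own, \<open>\<phi>\<close> can be moved through ring operations by \<open>\<phi>_simps\<close> without
  powers being expanded.
\<close>

locale cubic_extension =
  fixes q :: nat and \<phi> :: "'k::finite_field \<Rightarrow> 'k"
  assumes card_UNIV: "card (UNIV :: 'k set) = q ^ 3"
    and \<phi>_power: "\<phi> x = x ^ q"
    and \<phi>_add: "\<phi> (x + y) = \<phi> x + \<phi> y"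
begin

lemma q_gt_1: "q > 1"
proof (rule ccontr)
  assume "\<not> q > 1"
  then have "q ^ 3 \<le> 1"
    by (intro power_le_one) auto
  moreover have "card {0, 1 :: 'k} \<le> card (UNIV :: 'k set)"
    by (rule card_mono) auto
  ultimately show False
    by (simp add: card_UNIV)
qed

lemma \<phi>_zero [simp]: "\<phi> 0 = 0"
  using q_gt_1 by (simp add: \<phi>_power)

lemma \<phi>_one [simp]: "\<phi> 1 = 1"
  by (simp add: \<phi>_power)

lemma \<phi>_mult: "\<phi> (x * y) = \<phi> x * \<phi> y"
  by (simp add: \<phi>_power power_mult_distrib)

lemma \<phi>_minus: "\<phi> (- x) = - \<phi> x"
  using \<phi>_add[of "- x" x] by (simp add: eq_neg_iff_add_eq_0)

lemma \<phi>_diff: "\<phi> (x - y) = \<phi> x - \<phi> y"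
  using \<phi>_add[of x "- y"] by (simp add: \<phi>_minus)

lemma \<phi>_two [simp]: "\<phi> 2 = 2"
  using \<phi>_add[of 1 1] by simp

lemma \<phi>_three [simp]: "\<phi> 3 = 3"
  using \<phi>_add[of 1 2] by simp

lemma \<phi>_cube [simp]: "\<phi> (\<phi> (\<phi> x)) = x"
proof -
  have "\<phi> (\<phi> (\<phi> x)) = x ^ (q ^ 3)"
    by (simp add: \<phi>_power power3_eq_cube mult.assoc flip: power_mult)
  then show ?thesis
    using finite_field_power_card_eq_same[of x] by (simp add: card_UNIV)
qed

lemma \<phi>_eq_iff: "\<phi> x = \<phi> y \<longleftrightarrow> x = y"
  by (metis \<phi>_cube)

lemma \<phi>_eq_0_iff [simp]: "\<phi> x = 0 \<longleftrightarrow> x = 0"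
  using \<phi>_eq_iff[of x 0] by simp

lemmas \<phi>_simps = \<phi>_add \<phi>_diff \<phi>_minus \<phi>_mult

definition F :: "'k set"
  where "F = {x. \<phi> x = x}"

definition Tr :: "'k \<Rightarrow> 'k"
  where "Tr x = x + \<phi> x + \<phi> (\<phi> x)"

definition Nm :: "'k \<Rightarrow> 'k"
  where "Nm x = x * \<phi> x * \<phi> (\<phi> x)"

text \<open>
  \<open>adj\<close> is the adjoint of the cubic norm form, \<open>x * adj x = Nm x\<close>, and \<open>cross\<close> is its polarisation,
  \<open>adj (x + y) = adj x + cross x y + adj y\<close>.
\<close>

definition adj :: "'k \<Rightarrow> 'k"
  where "adj x = \<phi> x * \<phi> (\<phi> x)"

definition cross :: "'k \<Rightarrow> 'k \<Rightarrow> 'k"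
  where "cross x y = \<phi> x * \<phi> (\<phi> y) + \<phi> (\<phi> x) * \<phi> y"

lemma F_closed:
  "0 \<in> F" "1 \<in> F" "2 \<in> F" "Tr x \<in> F" "Nm x \<in> F"
  "x \<in> F \<Longrightarrow> - x \<in> F" "x \<in> F \<Longrightarrow> x ^ n \<in> F"
  "x \<in> F \<Longrightarrow> y \<in> F \<Longrightarrow> x + y \<in> F" "x \<in> F \<Longrightarrow> y \<in> F \<Longrightarrow> x - y \<in> F"
  "x \<in> F \<Longrightarrow> y \<in> F \<Longrightarrow> x * y \<in> F" "x \<in> F \<Longrightarrow> y \<in> F \<Longrightarrow> x / y \<in> F" "3 \<in> F"
  by (simp_all add: F_def Tr_def Nm_def \<phi>_simps add_ac mult_ac)
    (simp_all add: \<phi>_power power_divide flip: power_mult,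
      simp add: mult.commute[of n] power_mult)

lemma Tr_add: "Tr (x + y) = Tr x + Tr y" and Tr_diff: "Tr (x - y) = Tr x - Tr y"
  by (simp_all add: Tr_def \<phi>_simps)

lemma Tr_zero [simp]: "Tr 0 = 0"
  by (simp add: Tr_def)

lemma Tr_F_mult: "k \<in> F \<Longrightarrow> Tr (k * x) = k * Tr x" "k \<in> F \<Longrightarrow> Tr (x * k) = k * Tr x"
  by (simp_all add: Tr_def F_def \<phi>_simps algebra_simps)

lemma Tr_F: "k \<in> F \<Longrightarrow> Tr k = 3 * k"
  by (simp add: Tr_def F_def)

lemma adj_cross_simps [simp]:
  "adj 0 = 0" "adj 1 = 1" "Nm 0 = 0" "Nm 1 = 1" "cross x 0 = 0" "cross 0 x = 0"
  "cross x 1 = Tr x - x" "cross 1 x = Tr x - x"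
  by (simp_all add: adj_def Nm_def cross_def Tr_def)

text \<open>
  \<open>Tr (cross x y * z)\<close> is the symmetric trilinear form that belongs to the norm.
\<close>

lemma Tr_cross: "Tr (cross x y * z) = Tr (cross x z * y)"
  by (simp add: Tr_def cross_def \<phi>_simps algebra_simps)

lemma card_F_le: "card F \<le> q"
proof -
  define p :: "'k poly" where "p = monom 1 q - monom 1 1"
  have "coeff p q = 1"
    using q_gt_1 by (simp add: p_def)
  then have "p \<noteq> 0" by auto
  moreover have "degree p \<le> q"
    unfolding p_def using q_gt_1 by (intro degree_diff_le) (auto simp: degree_monom_eq)
  moreover have "F = {x. poly p x = 0}"
    by (simp add: F_def \<phi>_power p_def poly_monom)
  ultimately show ?thesis
    using card_poly_roots_bound[of p] by simp
qed

lemma card_Tr_fibre_le: "card {x. Tr x = b} \<le> q ^ 2"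
proof -
  define p :: "'k poly" where "p = monom 1 (q ^ 2) + monom 1 q + monom 1 1 - [:b:]"
  have q2: "q < q ^ 2"
    using q_gt_1 by (simp add: power2_eq_square)
  then have "coeff p (q ^ 2) = 1"
    using q_gt_1 by (simp add: p_def coeff_pCons split: nat.split)
  then have "p \<noteq> 0" by auto
  moreover have "degree p \<le> q ^ 2"
    unfolding p_def using q_gt_1 q2
    by (intro degree_diff_le degree_add_le) (auto simp: degree_monom_eq)
  moreover have "{x. Tr x = b} = {x. poly p x = 0}"
    by (auto simp: Tr_def \<phi>_power p_def poly_monom power2_eq_square power_mult algebra_simps)
  ultimately show ?thesis
    using card_poly_roots_bound[of p] by simp
qed

text \<open>
  \<open>F\<close> consists of roots of \<open>X ^ q - X\<close>, and a fibre of the trace of roots of a polynomial of degree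
  \<open>q ^ 2\<close>. As the fibres over \<open>F\<close> cover all \<open>q * q ^ 2\<close> elements, both bounds are attained.
\<close>

lemma card_F: "card F = q" and card_Tr_fibre: "b \<in> F \<Longrightarrow> card {x. Tr x = b} = q ^ 2"
proof -
  have "card (UNIV :: 'k set) = q * q ^ 2"
    by (simp add: card_UNIV power2_eq_square power3_eq_cube)
  note * = card_fibres_maximal[of UNIV F Tr "q ^ 2", OF _ _ _ _ this card_F_le]
  show "card F = q"
    by (rule *) (use card_Tr_fibre_le F_closed q_gt_1 in auto)
  show "card {x. Tr x = b} = q ^ 2" if "b \<in> F"
    using *(2)[OF _ _ _ _ _ that] card_Tr_fibre_le F_closed q_gt_1 by auto
qed

lemma card_Tr_mult_fibre:
  assumes "b \<in> F" "k \<noteq> 0"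
  shows "card {x. Tr (k * x) = b} = q ^ 2"
proof -
  have "bij_betw (\<lambda>x. k * x) {x. Tr (k * x) = b} {x. Tr x = b}"
    by (rule bij_betwI[of _ _ _ "\<lambda>x. x / k"]) (use assms in auto)
  then show ?thesis
    using card_Tr_fibre[OF assms(1)] by (simp add: bij_betw_same_card)
qed

text \<open>
  Eliminating \<open>\<phi> (\<phi> x)\<close> from the two conditions leaves a polynomial equation of degree \<open>q\<close>, whose
  leading coefficient \<open>\<phi> u - \<phi> (\<phi> u)\<close> vanishes only for \<open>u \<in> F\<close>.
\<close>

lemma card_Tr_pair_fibre_le:
  assumes "u \<notin> F"
  shows "card {x. Tr x = b \<and> Tr (u * x) = c} \<le> q"
proof -
  \<comment> \<open>the difference of the second condition and \<open>\<phi> (\<phi> u)\<close> times the first\<close>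
  define e where "e = \<phi> u - \<phi> (\<phi> u)"
  define p :: "'k poly" where "p = monom e q + monom (u - \<phi> (\<phi> u)) 1 - [:c - \<phi> (\<phi> u) * b:]"
  have "e \<noteq> 0"
    using assms by (simp add: e_def F_def \<phi>_eq_iff)
  then have "coeff p q \<noteq> 0"
    using q_gt_1 by (simp add: p_def coeff_pCons split: nat.split)
  then have "p \<noteq> 0" by auto
  moreover have "degree p \<le> q"
    unfolding p_def using q_gt_1
    by (intro degree_diff_le degree_add_le) (auto intro: order.trans[OF degree_monom_le])
  ultimately have "card {x. poly p x = 0} \<le> q"
    using card_poly_roots_bound[of p] by simp
  moreover have "{x. Tr x = b \<and> Tr (u * x) = c} \<subseteq> {x. poly p x = 0}"
    by (auto simp: Tr_def p_def e_def poly_monom \<phi>_mult \<phi>_power[symmetric] algebra_simps)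
  ultimately show ?thesis
    by (meson card_mono finite le_trans)
qed

lemma card_Tr_pair_fibre:
  assumes "u \<notin> F" "b \<in> F" "c \<in> F"
  shows "card {x. Tr x = b \<and> Tr (u * x) = c} = q"
proof -
  have "card (UNIV :: 'k set) = q ^ 2 * q"
    by (simp add: card_UNIV power2_eq_square power3_eq_cube)
  moreover have "card (F \<times> F) \<le> q ^ 2"
    by (simp add: card_F power2_eq_square)
  ultimately have "card {x \<in> UNIV. (Tr x, Tr (u * x)) = (b, c)} = q"
    by (intro card_fibres_maximal(2)[of UNIV "F \<times> F"])
      (use card_Tr_pair_fibre_le[OF assms(1)] F_closed assms q_gt_1 in auto)
  then show ?thesis by simp
qed

text \<open>
  The map \<open>x \<mapsto> Tr x - x\<close>, which is \<open>cross 1\<close>, behaves differently in characteristic 2. The next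
  lemmas determine its kernel and its fibres by means of \<open>y = Tr x\<close>, which satisfies
  \<open>2 * y = Tr (Tr x - x)\<close> in every characteristic.
\<close>

lemma two_Tr: "2 * Tr x = Tr (Tr x - x)"
  by (simp add: Tr_diff Tr_F F_closed)

lemma Tr_eq_self_iff: "Tr x - x = 0 \<longleftrightarrow> x \<in> F \<and> 2 * x = 0"
proof
  assume x: "Tr x - x = 0"
  then have "x = Tr x"
    by simp
  then have "x \<in> F"
    by (metis F_closed(4))
  then show "x \<in> F \<and> 2 * x = 0"
    using two_Tr[of x] x by simp
qed (auto simp: Tr_F)

lemma Tr_half_minus:
  assumes "y \<in> F" "2 * y = Tr r"
  shows "Tr (y - r) = y"
proof -
  have "Tr (y - r) = 3 * y - 2 * y"
    using assms by (simp add: Tr_diff Tr_F)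
  then show ?thesis
    by simp
qed

text \<open>
  An equation for \<open>x\<close> in \<open>K\<close> is traded for an equation for its trace \<open>y\<close> in \<open>F\<close>; the element is
  recovered as \<open>x = y - r s\<close>.
\<close>

lemma card_pairs_Tr_minus_self:
  "card {(s, x). P s (Tr x) \<and> Tr x - x = r s} = card {(s, y). y \<in> F \<and> P s y \<and> 2 * y = Tr (r s)}"
proof -
  have "bij_betw (\<lambda>(s, x). (s, Tr x)) {(s, x). P s (Tr x) \<and> Tr x - x = r s}
    {(s, y). y \<in> F \<and> P s y \<and> 2 * y = Tr (r s)}"
  proof (rule bij_betwI[of _ _ _ "\<lambda>(s, y). (s, y - r s)"])
    show "(\<lambda>(s, x). (s, Tr x)) \<in> {(s, x). P s (Tr x) \<and> Tr x - x = r s} \<rightarrow>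
      {(s, y). y \<in> F \<and> P s y \<and> 2 * y = Tr (r s)}"
      using two_Tr by (auto simp: F_closed)
  qed (auto simp: Tr_half_minus diff_eq_eq add.commute)
  then show ?thesis
    by (rule bij_betw_same_card)
qed

end

section \<open>The fixed points of triality in coordinates\<close>

type_synonym 'k coords = "((((('k \<times> 'k) \<times> 'k) \<times> 'k) \<times> 'k) \<times> 'k)"

context cubic_extension
begin

definition U :: "'k coords set"
  where "U = {(((((a, t), u), w), c), d). a \<in> F \<and> c \<in> F \<and> d \<in> F}"

text \<open>
  The coordinate \<open>w\<close> is put at root 9, not 8, because roots 9, 10, 8 are paired with 2, 3, 4 (to root
  11) and with 5, 6, 7 (to root 12); so these pairings become \<open>Tr (t * w)\<close> and \<open>Tr (u * w)\<close>.
\<close>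

fun embed :: "'k coords \<Rightarrow> 'k d4_tuple"
  where "embed (((((a, t), u), w), c), d) =
    (a, t, \<phi> t, \<phi> (\<phi> t), u, \<phi> u, \<phi> (\<phi> u), \<phi> (\<phi> w), w, \<phi> w, c, d)"

lemma embed_U: "embed ` U = {a. d4_triality q a = a}"
proof (intro equalityI subsetI)
  fix a :: "'k d4_tuple" assume "a \<in> {a. d4_triality q a = a}"
  then obtain a1 a2 a3 a4 a5 a6 a7 a8 a9 a10 a11 a12
    where a: "a = (a1, a2, a3, a4, a5, a6, a7, a8, a9, a10, a11, a12)" "a1 \<in> F" "a11 \<in> F" "a12 \<in> F"
      "\<phi> a2 = a3" "\<phi> a3 = a4" "\<phi> a5 = a6" "\<phi> a6 = a7" "\<phi> a9 = a10" "\<phi> a10 = a8"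
    by (cases a rule: d4_tuple_cases) (auto simp: F_def \<phi>_power)
  then have "a = embed (((((a1, a2), a5), a9), a11), a12)"
    by simp
  then show "a \<in> embed ` U"
    by (rule image_eqI) (use a(2-4) in \<open>simp add: U_def\<close>)
qed (auto simp: U_def F_def \<phi>_power[symmetric])

lemma inj_embed: "inj embed"
  by (rule injI) auto

text \<open>
  \<^const>\<open>d4_mult\<close> on the fixed points, where the sums over orbits of triality are traces.
\<close>

fun mult :: "'k coords \<Rightarrow> 'k coords \<Rightarrow> 'k coords"
  where "mult (((((a, t), u), w), c), d) (((((a', t'), u'), w'), c'), d') =
    (((((a + a', t + t'),
      u + u' - t * a'),
      w + w' - cross u t' + a' * (adj t + cross t t')),
      c + c' - Tr (w * t') + Tr (u * adj t') - a' * (Nm t + Tr (adj t * t') + Tr (t * adj t'))),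
      d + d' - Tr (w * u') - c * a' + Tr (adj u * t') + Tr (cross u u' * t')
        - a' * Tr ((u + u') * (adj t + cross t t')) + a' ^ 2 * (2 * Nm t + Tr (adj t * t')))"

lemma embed_mult:
  assumes "g \<in> U" "h \<in> U"
  shows "d4_mult (embed g) (embed h) = embed (mult g h)"
proof -
  obtain a t u w c d where g: "g = (((((a, t), u), w), c), d)"
    by (metis surj_pair)
  obtain a' t' u' w' c' d' where h: "h = (((((a', t'), u'), w'), c'), d')"
    by (metis surj_pair)
  have "\<phi> a = a" "\<phi> a' = a'"
    using assms by (auto simp: g h U_def F_def)
  then show ?thesis
    by (simp add: g h Tr_def Nm_def adj_def cross_def \<phi>_simps algebra_simps power2_eq_square)
qed

definition commutes :: "'k coords \<Rightarrow> 'k coords \<Rightarrow> bool"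
  where "commutes g h \<longleftrightarrow> g \<in> U \<and> h \<in> U \<and> mult g h = mult h g"

lemma commutes_sym: "commutes g h \<longleftrightarrow> commutes h g"
  by (auto simp: commutes_def)

lemma card_U: "card U = q ^ 12"
proof -
  have "U = ((((F \<times> UNIV) \<times> UNIV) \<times> UNIV) \<times> F) \<times> F"
    by (auto simp: U_def)
  then show ?thesis
    by (simp add: card_cartesian_product card_F card_UNIV eval_nat_numeral mult_ac)
qed

text \<open>
  The action of an element of the maximal torus. It has weight \<open>k\<close> on the simple root 2 and is trivial
  on root 1, which fixes the weights of the remaining coordinates.
\<close>

fun scale :: "'k \<Rightarrow> 'k coords \<Rightarrow> 'k coords"
  where "scale k (((((a, t), u), w), c), d) = (((((a, k * t), k * u), adj k * w), Nm k * c), Nm k * d)"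

lemma mult_scale:
  assumes "g \<in> U" "h \<in> U"
  shows "mult (scale k g) (scale k h) = scale k (mult g h)"
proof -
  obtain a t u w c d where g: "g = (((((a, t), u), w), c), d)"
    by (metis surj_pair)
  obtain a' t' u' w' c' d' where h: "h = (((((a', t'), u'), w'), c'), d')"
    by (metis surj_pair)
  have "\<phi> a = a" "\<phi> a' = a'"
    using assms by (auto simp: g h U_def F_def)
  then show ?thesis
    by (simp add: g h Tr_def Nm_def adj_def cross_def \<phi>_simps algebra_simps power2_eq_square)
qed

lemma scale_mult: "scale k (scale l g) = scale (k * l) g"
proof -
  obtain a t u w c d where "g = (((((a, t), u), w), c), d)"
    by (metis surj_pair)
  then show ?thesis
    by (simp add: adj_def Nm_def \<phi>_mult)
qed

lemma scale_one: "scale 1 g = g"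
proof -
  obtain a t u w c d where "g = (((((a, t), u), w), c), d)"
    by (metis surj_pair)
  then show ?thesis
    by (simp add: adj_def Nm_def)
qed

lemma scale_inverse: "k \<noteq> 0 \<Longrightarrow> scale k (scale (inverse k) g) = g"
  "k \<noteq> 0 \<Longrightarrow> scale (inverse k) (scale k g) = g"
  by (simp_all add: scale_mult scale_one)

lemma scale_U: "g \<in> U \<Longrightarrow> scale k g \<in> U"
  by (auto simp: U_def F_closed)

lemma commutes_scale:
  assumes "k \<noteq> 0"
  shows "commutes (scale k g) (scale k h) \<longleftrightarrow> commutes g h"
proof -
  have U: "scale k g \<in> U \<longleftrightarrow> g \<in> U" for g
    using scale_U[of g k] scale_U[of "scale k g" "inverse k"] scale_inverse(2)[OF assms] by auto
  have inj: "scale k g = scale k h \<longleftrightarrow> g = h" for g h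
    using scale_inverse(2)[OF assms] by metis
  have "mult (scale k g) (scale k h) = mult (scale k h) (scale k g) \<longleftrightarrow> mult g h = mult h g"
    if "g \<in> U" "h \<in> U"
    unfolding mult_scale[OF that] mult_scale[OF that(2,1)] by (rule inj)
  then show ?thesis
    unfolding commutes_def U by blast
qed

fun tcoord :: "'k coords \<Rightarrow> 'k"
  where "tcoord (((((a, t), u), w), c), d) = t"

lemma tcoord_scale: "tcoord (scale k g) = k * tcoord g"
proof -
  obtain a t u w c d where "g = (((((a, t), u), w), c), d)"
    by (metis surj_pair)
  then show ?thesis by simp
qed

text \<open>
  The commuting pairs with prescribed images in the quotient of \<open>U\<close> by the subgroup \<open>t = 0\<close>.
\<close>

definition pairs :: "'k \<Rightarrow> 'k \<Rightarrow> ('k coords \<times> 'k coords) set"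
  where "pairs s t = {(g, h). commutes g h \<and> tcoord g = s \<and> tcoord h = t}"

lemma bij_scale: "k \<noteq> 0 \<Longrightarrow> bij (scale k)"
  by (rule o_bij[of "scale (inverse k)"]) (simp_all add: fun_eq_iff scale_inverse del: split_paired_All)

lemma card_pairs_scale:
  assumes "k \<noteq> 0"
  shows "card (pairs (k * s) (k * t)) = card (pairs s t)"
  unfolding pairs_def
  by (rule card_pairs_reindex[OF bij_scale[OF assms]])
    (simp_all add: assms commutes_scale tcoord_scale)

lemma card_pairs_sym: "card (pairs s t) = card (pairs t s)"
  unfolding pairs_def
  by (rule card_pairs_swap) (use commutes_sym in blast)

text \<open>
  Scaling reduces the pairs with \<open>t \<noteq> 0\<close> in the first element to \<open>t = 1\<close>. Those with \<open>t = 0\<close> there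
  and \<open>t \<noteq> 0\<close> in the second element are reduced likewise after exchanging the two elements.
\<close>

lemma card_commuting_pairs:
  "card {(g, h). commutes g h} =
    card (pairs 0 0) + (q ^ 3 - 1) * (card (pairs 1 0) + (\<Sum>t\<in>UNIV. card (pairs 1 t)))"
proof -
  have total: "card {(g, h). commutes g h} = (\<Sum>s\<in>UNIV. \<Sum>t\<in>UNIV. card (pairs s t))"
    unfolding pairs_def by (rule card_pairs_fibres)
  have nonzero: "(\<Sum>t\<in>UNIV. card (pairs s t)) = (\<Sum>t\<in>UNIV. card (pairs 1 t))" if "s \<noteq> 0" for s
  proof -
    have "(\<Sum>t\<in>UNIV. card (pairs s t)) = (\<Sum>t\<in>UNIV. card (pairs s (s * t)))"
      by (rule sum.reindex_bij_betw[symmetric], rule bij_betwI[of _ _ _ "\<lambda>t. t / s"]) (use that in auto)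
    also have "\<dots> = (\<Sum>t\<in>UNIV. card (pairs 1 t))"
      using card_pairs_scale[OF that, of 1] by simp
    finally show ?thesis .
  qed
  have zero: "card (pairs 0 t) = card (pairs 1 0)" if "t \<noteq> 0" for t
    using card_pairs_scale[OF that, of 0 1] card_pairs_sym[of 0 1] by simp
  have "(\<Sum>s\<in>UNIV. \<Sum>t\<in>UNIV. card (pairs s t)) =
    (\<Sum>t\<in>UNIV. card (pairs 0 t)) + (\<Sum>s\<in>UNIV - {0}. \<Sum>t\<in>UNIV. card (pairs s t))"
    by (simp add: sum.remove)
  also have "(\<Sum>t\<in>UNIV. card (pairs 0 t)) = card (pairs 0 0) + (\<Sum>t\<in>UNIV - {0}. card (pairs 0 t))"
    by (simp add: sum.remove)
  also have "(\<Sum>t\<in>UNIV - {0}. card (pairs 0 t)) = (q ^ 3 - 1) * card (pairs 1 0)"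
    by (simp add: zero card_Diff_subset card_UNIV)
  also have "(\<Sum>s\<in>UNIV - {0}. \<Sum>t\<in>UNIV. card (pairs s t)) =
    (q ^ 3 - 1) * (\<Sum>t\<in>UNIV. card (pairs 1 t))"
  proof -
    have "(\<Sum>s\<in>UNIV - {0}. \<Sum>t\<in>UNIV. card (pairs s t)) =
      (\<Sum>s\<in>UNIV - {0 :: 'k}. \<Sum>t\<in>UNIV. card (pairs 1 t))"
      by (rule sum.cong[OF refl], rule nonzero) simp
    then show ?thesis
      by (simp add: card_Diff_subset card_UNIV)
  qed
  finally show ?thesis
    unfolding total by (simp add: distrib_left)
qed

section \<open>Commuting pairs with one element in the Heisenberg group\<close>

text \<open>
  A nonzero linear functional of \<open>(a, u, w, c)\<close> takes each value in \<open>F\<close> exactly \<open>q ^ 7\<close> times, and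
  \<open>d\<close> is free. The equation is solved for the last of \<open>a, u, w, c\<close> that occurs in it; their
  coefficients are \<open>c', w', u', a'\<close>.
\<close>

lemma card_symplectic:
  fixes \<tau> :: 'k
  assumes "a' \<in> F" "c' \<in> F" "b \<in> F" and nonzero: "a' \<noteq> 0 \<or> u' \<noteq> 0 \<or> w' \<noteq> 0 \<or> c' \<noteq> 0"
  shows "card {(((((a, t), u), w), c), d). a \<in> F \<and> t = \<tau> \<and> c \<in> F \<and> d \<in> F \<and>
    Tr (u' * w) + c * a' = Tr (w' * u) + c' * a + b} = q ^ 8"
proof -
  have at: "card {(a, t). a \<in> F \<and> t = \<tau>} = q"
    using card_fibres[of "\<lambda>a. a \<in> F" "\<lambda>a t. a \<in> F \<and> t = \<tau>" 1] by (simp add: card_F)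
  have atu: "card {((a, t), u :: 'k). a \<in> F \<and> t = \<tau>} = q ^ 4"
    by (subst card_fibres[where R = "\<lambda>(a, t). a \<in> F \<and> t = \<tau>" and k = "q ^ 3"])
      (auto simp: at card_F card_UNIV eval_nat_numeral)
  have atuw: "card {(((a, t), u :: 'k), w :: 'k). a \<in> F \<and> t = \<tau>} = q ^ 7"
    by (subst card_fibres[where R = "\<lambda>((a, t), u). a \<in> F \<and> t = \<tau>" and k = "q ^ 3"])
      (auto simp: atu card_F card_UNIV eval_nat_numeral)
  have "card {((((a, t), u), w), c). a \<in> F \<and> t = \<tau> \<and> c \<in> F \<and>
    Tr (u' * w) + c * a' = Tr (w' * u) + c' * a + b} = q ^ 7" (is "card ?X = _")
  proof (cases "a' = 0")
    case False
    have "{c. c \<in> F \<and> Tr (u' * w) + c * a' = Tr (w' * u) + c' * a + b} =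
      {(Tr (w' * u) + c' * a + b - Tr (u' * w)) / a'}" if "a \<in> F" for a u w
      using False assms(1-3) that by (auto simp: field_simps intro!: F_closed)
    then show ?thesis
      by (subst card_fibres[where R = "\<lambda>(((a, t), u), w). a \<in> F \<and> t = \<tau>" and k = 1])
        (auto simp: atuw)
  next
    case a': True
    have "card ?X = card {(((a, t), u), w). a \<in> F \<and> t = \<tau> \<and>
      Tr (u' * w) = Tr (w' * u) + c' * a + b} * q"
      by (rule card_fibres) (auto simp: a' card_F)
    also have "card {(((a, t), u), w). a \<in> F \<and> t = \<tau> \<and>
      Tr (u' * w) = Tr (w' * u) + c' * a + b} = q ^ 6"
    proof (cases "u' = 0")
      case False
      show ?thesis
        by (subst card_fibres[where R = "\<lambda>((a, t), u). a \<in> F \<and> t = \<tau>" and k = "q ^ 2"])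
          (auto simp: atu card_F card_Tr_mult_fibre False F_closed assms(1-3) eval_nat_numeral)
    next
      case u': True
      have "card {(((a, t), u), w :: 'k). a \<in> F \<and> t = \<tau> \<and> 0 = Tr (w' * u) + c' * a + b} =
        card {((a, t), u). a \<in> F \<and> t = \<tau> \<and> Tr (w' * u) = - (c' * a + b)} * q ^ 3"
      proof -
        have "Tr (w' * u) + c' * a + b = 0 \<longleftrightarrow> Tr (w' * u) = - (c' * a + b)" for a u
          by (simp only: eq_neg_iff_add_eq_0 add.assoc)
        then show ?thesis
          by (intro card_fibres) (auto simp: card_UNIV eq_commute[of 0])
      qed
      also have "card {((a, t), u). a \<in> F \<and> t = \<tau> \<and> Tr (w' * u) = - (c' * a + b)} = q ^ 3"
      proof (cases "w' = 0")
        case False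
        show ?thesis
          by (subst card_fibres[where R = "\<lambda>(a, t). a \<in> F \<and> t = \<tau>" and k = "q ^ 2"])
            (auto simp: at card_F card_Tr_mult_fibre False F_closed assms(1-3) eval_nat_numeral)
      next
        case True
        have c': "c' \<noteq> 0"
          using nonzero a' u' True by simp
        have "{(a, t). a \<in> F \<and> t = \<tau> \<and> 0 = - (c' * a + b)} = {(- b / c', \<tau>)}"
          using c' assms(2,3) by (auto simp: field_simps eq_neg_iff_add_eq_0 intro!: F_closed)
        then show ?thesis
          by (subst card_fibres[where R = "\<lambda>(a, t). a \<in> F \<and> t = \<tau> \<and> 0 = - (c' * a + b)"
            and k = "q ^ 3"]) (auto simp: True card_UNIV)
      qed
      finally show ?thesis
        by (simp add: u' flip: power_add)
    qed
    finally show ?thesis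
      by (simp flip: power_Suc2)
  qed
  then show ?thesis
    by (subst card_fibres[where R = "\<lambda>((((a, t), u), w), c). a \<in> F \<and> t = \<tau> \<and> c \<in> F \<and>
      Tr (u' * w) + c * a' = Tr (w' * u) + c' * a + b" and k = q])
      (auto simp: card_F simp flip: power_Suc2)
qed

text \<open>
  The three conditions with the factor \<open>\<tau>\<close> say that the commutator of the two elements is central.
  The last condition is an affine equation for the first element, whose linear part is the
  symplectic form.
\<close>

lemma commutes_Heisenberg:
  assumes "\<tau> = 0 \<or> \<tau> = 1"
  shows "commutes (((((a, \<tau>), u), w), c), d) (((((a', 0), u'), w'), c'), d') \<longleftrightarrow>
    a \<in> F \<and> c \<in> F \<and> d \<in> F \<and> a' \<in> F \<and> c' \<in> F \<and> d' \<in> F \<and>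
    \<tau> * a' = 0 \<and> \<tau> * (Tr u' - u') = 0 \<and> \<tau> * (Tr w' - Tr u') = 0 \<and>
    Tr (u' * w) + c * a' = Tr (w' * u) + c' * a - \<tau> * Tr (adj u')"
proof (cases "a \<in> F \<and> c \<in> F \<and> d \<in> F \<and> a' \<in> F \<and> c' \<in> F \<and> d' \<in> F")
  case True
  \<comment> \<open>for \<open>\<tau> = 1\<close> this is the mixed term of the last coordinate; the condition on \<open>u'\<close> makes it vanish\<close>
  have "Tr (cross u' u) = Tr ((Tr u' - u') * u)"
    using Tr_cross[of u' u 1] by simp
  then show ?thesis
    using assms True by (auto simp: commutes_def U_def Tr_diff algebra_simps)
qed (auto simp: commutes_def U_def)

text \<open>
  The \<open>q\<close> central elements commute with all \<open>q ^ 9\<close> elements that have \<open>t = \<tau>\<close>, and every other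
  element that satisfies \<open>R\<close> with \<open>q ^ 8\<close> of them. The summand \<open>q ^ 9\<close> on the left avoids a
  subtraction of natural numbers.
\<close>

lemma card_pairs_Heisenberg:
  assumes \<tau>: "\<tau> = 0 \<or> \<tau> = 1"
  defines "R \<equiv> \<lambda>(((((a', t' :: 'k), u'), w'), c'), d'). a' \<in> F \<and> t' = 0 \<and> c' \<in> F \<and> d' \<in> F \<and>
    \<tau> * a' = 0 \<and> \<tau> * (Tr u' - u') = 0 \<and> \<tau> * (Tr w' - Tr u') = 0"
  shows "card (pairs \<tau> 0) + q ^ 9 = q ^ 10 + card {h. R h} * q ^ 8"
proof -
  define Z :: "'k coords \<Rightarrow> bool" where
    "Z = (\<lambda>(((((a', t'), u'), w'), c'), d'). a' = 0 \<and> u' = 0 \<and> w' = 0 \<and> c' = 0)"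
  define P where "P h g \<longleftrightarrow> commutes g h \<and> tcoord g = \<tau> \<and> tcoord h = 0" for g h
  have R: "R h" if "P h g" for g h
    using that \<tau> unfolding P_def R_def
    by (cases g; cases h) (auto simp: commutes_Heisenberg)
  have centre: "card {g. P h g} = q ^ 9" if h: "R h" "Z h" for h
  proof -
    obtain d' where h: "h = (((((0, 0), 0), 0), 0), d')" "d' \<in> F"
      using h unfolding R_def Z_def by (cases h) auto
    have "{g. P h g} = ((((F \<times> {\<tau>}) \<times> UNIV) \<times> UNIV) \<times> F) \<times> F"
      using \<tau> h(2) unfolding P_def h(1) by (auto simp: commutes_Heisenberg F_closed)
    then show ?thesis
      by (simp add: card_cartesian_product card_F card_UNIV eval_nat_numeral mult_ac)
  qed
  have noncentre: "card {g. P h g} = q ^ 8" if h: "R h" "\<not> Z h" for h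
  proof -
    obtain a' u' w' c' d' where h: "h = (((((a', 0), u'), w'), c'), d')" "a' \<in> F" "c' \<in> F" "d' \<in> F"
      "\<tau> * a' = 0" "\<tau> * (Tr u' - u') = 0" "\<tau> * (Tr w' - Tr u') = 0"
      "a' \<noteq> 0 \<or> u' \<noteq> 0 \<or> w' \<noteq> 0 \<or> c' \<noteq> 0"
      using h unfolding R_def Z_def by (cases h) auto
    have "{g. P h g} = {(((((a, t), u), w), c), d). a \<in> F \<and> t = \<tau> \<and> c \<in> F \<and> d \<in> F \<and>
      Tr (u' * w) + c * a' = Tr (w' * u) + c' * a + - (\<tau> * Tr (adj u'))}"
      using \<tau> h(2-7) unfolding P_def h(1) by (auto simp: commutes_Heisenberg)
    then show ?thesis
      using card_symplectic[of a' c' "- (\<tau> * Tr (adj u'))" u' w' \<tau>] h \<tau> by (auto simp: F_closed)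
  qed
  have Z: "card {h. R h \<and> Z h} = q"
  proof -
    have "{h. R h \<and> Z h} = (((({0} \<times> {0}) \<times> {0}) \<times> {0}) \<times> {0}) \<times> F"
      by (auto simp: R_def Z_def F_closed)
    then show ?thesis
      by (simp add: card_cartesian_product card_F)
  qed
  have "card (pairs \<tau> 0) = card {(h, g). P h g}"
    unfolding pairs_def P_def by (rule card_pairs_swap) simp
  also have "\<dots> = card {(h, g). P h g \<and> Z h} + card {(h, g). P h g \<and> \<not> Z h}"
    using card_Collect_split[of "\<lambda>(h, g). P h g" "\<lambda>(h, g). Z h"]
    by (simp only: case_prod_unfold)
  also have "card {(h, g). P h g \<and> Z h} = card {h. R h \<and> Z h} * q ^ 9"
    by (rule card_fibres, simp add: centre, blast intro: R)
  also have "card {(h, g). P h g \<and> \<not> Z h} = card {h. R h \<and> \<not> Z h} * q ^ 8"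
    by (rule card_fibres, simp add: noncentre, blast intro: R)
  finally show ?thesis
    unfolding card_Collect_split[of R Z] Z by (simp add: distrib_right flip: power_Suc)
qed

lemma card_pairs_0_0: "card (pairs 0 0) + q ^ 9 = q ^ 10 + q ^ 17"
proof -
  have "{(((((a', t' :: 'k), u' :: 'k), w' :: 'k), c'), d'). a' \<in> F \<and> t' = 0 \<and> c' \<in> F \<and> d' \<in> F} =
    ((((F \<times> {0}) \<times> UNIV) \<times> UNIV) \<times> F) \<times> F"
    by auto
  then have "card {(((((a', t' :: 'k), u' :: 'k), w' :: 'k), c'), d'). a' \<in> F \<and> t' = 0 \<and> c' \<in> F \<and> d' \<in> F} =
    q ^ 9"
    by (simp add: card_cartesian_product card_F card_UNIV eval_nat_numeral mult_ac)
  then show ?thesis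
    using card_pairs_Heisenberg[of 0] by (simp flip: power_add)
qed

lemma card_pairs_1_0: "card (pairs 1 0) + q ^ 9 = q ^ 10 + card {y \<in> F. 2 * y = 0} * q ^ 12"
proof -
  let ?Y = "{y \<in> F. 2 * y = 0}"
  have "card {(((((a', t' :: 'k), u'), w'), c'), d'). a' \<in> F \<and> t' = 0 \<and> c' \<in> F \<and> d' \<in> F \<and>
      a' = 0 \<and> Tr u' = u' \<and> Tr w' = Tr u'} =
    card {((((a' :: 'k, t' :: 'k), u'), w'), c'). t' = 0 \<and> c' \<in> F \<and> a' = 0 \<and> u' \<in> ?Y \<and> Tr w' = Tr u'} * q"
    by (rule card_fibres) (use Tr_eq_self_iff in \<open>auto simp: card_F F_closed\<close>)
  also have "card {((((a' :: 'k, t' :: 'k), u'), w'), c'). t' = 0 \<and> c' \<in> F \<and> a' = 0 \<and> u' \<in> ?Y \<and>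
      Tr w' = Tr u'} =
    card {(((a' :: 'k, t' :: 'k), u'), w'). t' = 0 \<and> a' = 0 \<and> u' \<in> ?Y \<and> Tr w' = Tr u'} * q"
    by (rule card_fibres) (auto simp: card_F)
  also have "card {(((a' :: 'k, t' :: 'k), u'), w'). t' = 0 \<and> a' = 0 \<and> u' \<in> ?Y \<and> Tr w' = Tr u'} =
    card {((a' :: 'k, t' :: 'k), u'). t' = 0 \<and> a' = 0 \<and> u' \<in> ?Y} * q ^ 2"
    by (rule card_fibres) (auto simp: card_Tr_fibre F_closed)
  also have "{((a' :: 'k, t' :: 'k), u'). t' = 0 \<and> a' = 0 \<and> u' \<in> ?Y} = ({0} \<times> {0}) \<times> ?Y"
    by auto
  finally show ?thesis
    using card_pairs_Heisenberg[of 1]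
    by (simp add: card_cartesian_product eval_nat_numeral mult_ac)
qed

section \<open>Centralisers of the elements with \<open>t = 1\<close>\<close>

text \<open>
  For \<open>t = 1\<close>, the equations at roots 11 and 12 are solved for the terms that contain the last
  unknowns: \<open>w'\<close> occurs only as \<open>Tr w'\<close> and \<open>Tr (u * w')\<close>, and \<open>c'\<close> only as \<open>c' * a\<close>. The right-hand
  sides below depend on the unknowns \<open>s\<close> and \<open>u'\<close> only.
\<close>

definition rhs11 :: "'k \<Rightarrow> 'k \<Rightarrow> 'k \<Rightarrow> 'k \<Rightarrow> 'k \<Rightarrow> 'k"
  where "rhs11 a u w s u' =
    Tr u' + Tr (w * s) - Tr (u * adj s) + s * a * (1 + Tr s + Tr (adj s)) - a * (Nm s + Tr (adj s) + Tr s)"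

definition rhs12 :: "'k \<Rightarrow> 'k \<Rightarrow> 'k \<Rightarrow> 'k \<Rightarrow> 'k \<Rightarrow> 'k \<Rightarrow> 'k"
  where "rhs12 a u w c s u' =
    Tr (adj u') + Tr (cross u' u) - a * Tr ((u + u') * (adj s + cross s 1)) + a ^ 2 * (2 * Nm s + Tr (adj s))
    - (Tr (adj u * s) + Tr (cross u u' * s) - Tr (w * u') - c * (s * a)
      - s * a * Tr ((u + u') * (1 + cross 1 s)) + (s * a) ^ 2 * (2 + Tr s))"

lemma commutes_one:
  "commutes (((((a, 1), u), w), c), d) (((((a', s), u'), w'), c'), d') \<longleftrightarrow>
    a \<in> F \<and> c \<in> F \<and> d \<in> F \<and> a' \<in> F \<and> c' \<in> F \<and> d' \<in> F \<and> a' = s * a \<and>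
    Tr u' - u' = cross u s - a' * (1 + cross 1 s) + a * (adj s + cross s 1) \<and>
    Tr w' = rhs11 a u w s u' \<and> Tr (u * w') + c' * a = rhs12 a u w c s u'"
proof -
  have "u + u' - a' = u' + u - s * a \<longleftrightarrow> a' = s * a"
    by (auto simp: algebra_simps)
  moreover have "w + w' - cross u s + a' * (1 + cross 1 s) = w' + w - cross u' 1 + a * (adj s + cross s 1)
      \<longleftrightarrow> Tr u' - u' = cross u s - a' * (1 + cross 1 s) + a * (adj s + cross s 1)"
    by (auto simp: algebra_simps)
  moreover have "c + c' - Tr (w * s) + Tr (u * adj s) - s * a * (1 + Tr s + Tr (adj s)) =
      c' + c - Tr w' + Tr u' - a * (Nm s + Tr (adj s) + Tr s)
      \<longleftrightarrow> Tr w' = rhs11 a u w s u'"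
    by (auto simp: rhs11_def algebra_simps)
  moreover have "d + d' - Tr (w * u') - c * (s * a) + Tr (adj u * s) + Tr (cross u u' * s)
      - s * a * Tr ((u + u') * (1 + cross 1 s)) + (s * a) ^ 2 * (2 + Tr s) =
    d' + d - Tr (w' * u) - c' * a + Tr (adj u') + Tr (cross u' u)
      - a * Tr ((u' + u) * (adj s + cross s 1)) + a ^ 2 * (2 * Nm s + Tr (adj s))
      \<longleftrightarrow> Tr (u * w') + c' * a = rhs12 a u w c s u'"
    unfolding rhs12_def mult.commute[of u w'] add.commute[of u' u] add.commute[of d' d]
    by (simp add: eq_diff_eq diff_eq_eq) (auto simp: algebra_simps)
  ultimately show ?thesis
    unfolding commutes_def U_def mult.simps
    by (auto simp del: adj_cross_simps(7,8) simp: add.commute)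
qed

lemma rhs11_F: "a \<in> F \<Longrightarrow> s * a \<in> F \<Longrightarrow> rhs11 a u w s u' \<in> F"
  unfolding rhs11_def by (assumption | rule F_closed)+

lemma rhs12_F: "a \<in> F \<Longrightarrow> c \<in> F \<Longrightarrow> s * a \<in> F \<Longrightarrow> rhs12 a u w c s u' \<in> F"
  unfolding rhs12_def by (assumption | rule F_closed)+

text \<open>
  Since \<open>a \<noteq> 0\<close>, the equation \<open>a' = s * a\<close> forces \<open>s \<in> F\<close>, and \<open>c'\<close> is determined by the last
  equation. This leaves \<open>q ^ 2\<close> values of \<open>w'\<close> with a given trace, \<open>q\<close> values of \<open>d'\<close>, and the pairs
  \<open>(s, u')\<close>, which correspond to pairs \<open>(s, y)\<close> with \<open>y = Tr u'\<close>.
\<close>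

lemma card_centraliser_generic:
  assumes a: "a \<in> F" "a \<noteq> 0" and "c \<in> F" "d \<in> F"
  shows "card {h. commutes (((((a, 1), u), w), c), d) h} =
    card {(s, y). y \<in> F \<and> s \<in> F \<and> 2 * y = 2 * (s * Tr u) + 3 * (a * (s - s ^ 2))} * q ^ 3"
proof -
  let ?r = "\<lambda>s. s * (Tr u - u) + a * (s - s ^ 2)"
  have s_F: "s \<in> F" if "s * a \<in> F" for s
    using F_closed(11)[OF that a(1)] a(2) by simp
  have iff: "commutes (((((a, 1), u), w), c), d) (((((a', s), u'), w'), c'), d') \<longleftrightarrow>
    s \<in> F \<and> a' = s * a \<and> Tr u' - u' = ?r s \<and> Tr w' = rhs11 a u w s u' \<and>
    c' = (rhs12 a u w c s u' - Tr (u * w')) / a \<and> d' \<in> F" for a' s u' w' c' d'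
  proof (cases "s \<in> F \<and> a' = s * a")
    case True
    have "cross u s - a' * (1 + cross 1 s) + a * (adj s + cross s 1) = ?r s"
      using True by (simp add: Tr_F) (simp add: adj_def cross_def Tr_def F_def power2_eq_square algebra_simps)
    moreover have "Tr (u * w') + c' * a = rhs12 a u w c s u' \<longleftrightarrow>
      c' = (rhs12 a u w c s u' - Tr (u * w')) / a"
      using a(2) by (auto simp: field_simps)
    moreover have "(rhs12 a u w c s u' - Tr (u * w')) / a \<in> F"
      using True assms by (auto intro!: F_closed(9,11) rhs12_F) (auto intro: F_closed)
    ultimately show ?thesis
      using True assms by (auto simp: commutes_one F_closed)
  next
    case False
    then show ?thesis
      using s_F by (auto simp: commutes_one)
  qed
  have "card {h. commutes (((((a, 1), u), w), c), d) h} =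
    card {(((((a', s), u'), w'), c'), d'). s \<in> F \<and> a' = s * a \<and> Tr u' - u' = ?r s \<and>
      Tr w' = rhs11 a u w s u' \<and> c' = (rhs12 a u w c s u' - Tr (u * w')) / a \<and> d' \<in> F}"
    by (rule arg_cong[of _ _ card]) (auto simp: iff)
  also have "\<dots> = card {((((a', s), u'), w'), c'). s \<in> F \<and> a' = s * a \<and> Tr u' - u' = ?r s \<and>
      Tr w' = rhs11 a u w s u' \<and> c' = (rhs12 a u w c s u' - Tr (u * w')) / a} * q"
    by (rule card_fibres) (auto simp: card_F)
  also have "card {((((a', s), u'), w'), c'). s \<in> F \<and> a' = s * a \<and> Tr u' - u' = ?r s \<and>
      Tr w' = rhs11 a u w s u' \<and> c' = (rhs12 a u w c s u' - Tr (u * w')) / a} =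
    card {(((a', s), u'), w'). s \<in> F \<and> a' = s * a \<and> Tr u' - u' = ?r s \<and> Tr w' = rhs11 a u w s u'} * 1"
    by (rule card_fibres) auto
  also have "card {(((a', s), u'), w'). s \<in> F \<and> a' = s * a \<and> Tr u' - u' = ?r s \<and>
      Tr w' = rhs11 a u w s u'} =
    card {((a', s), u'). s \<in> F \<and> a' = s * a \<and> Tr u' - u' = ?r s} * q ^ 2"
    by (rule card_fibres) (auto intro!: card_Tr_fibre rhs11_F F_closed a)
  also have "card {((a', s), u'). s \<in> F \<and> a' = s * a \<and> Tr u' - u' = ?r s} =
    card {(s, u'). s \<in> F \<and> Tr u' - u' = ?r s}"
    by (rule bij_betw_same_card[of "\<lambda>((a', s), u'). (s, u')"],
      rule bij_betwI[of _ _ _ "\<lambda>(s, u'). ((s * a, s), u')"]) auto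
  also have "\<dots> = card {(s, y). y \<in> F \<and> s \<in> F \<and> 2 * y = Tr (?r s)}"
    by (rule card_pairs_Tr_minus_self[of "\<lambda>s y. s \<in> F"])
  also have "{(s, y). y \<in> F \<and> s \<in> F \<and> 2 * y = Tr (?r s)} =
    {(s, y). y \<in> F \<and> s \<in> F \<and> 2 * y = 2 * (s * Tr u) + 3 * (a * (s - s ^ 2))}"
  proof -
    have "Tr (?r s) = 2 * (s * Tr u) + 3 * (a * (s - s ^ 2))" if "s \<in> F" for s
      using that a(1) by (simp add: Tr_add Tr_F_mult Tr_F F_closed flip: two_Tr)
    then show ?thesis
      by auto
  qed
  finally show ?thesis
    by (simp add: power2_eq_square power3_eq_cube mult_ac)
qed

text \<open>
  For odd \<open>q\<close> the equation determines \<open>y\<close>. In characteristic 2 it reads \<open>a * (s - s ^ 2) = 0\<close>, so that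
  \<open>s\<close> is 0 or 1 and \<open>y\<close> is free.
\<close>

lemma card_quadratic:
  assumes "a \<in> F" "a \<noteq> 0" "T \<in> F"
  shows "card {(s, y). y \<in> F \<and> s \<in> F \<and> 2 * y = 2 * (s * T) + 3 * (a * (s - s ^ 2))} =
    (if (2 :: 'k) = 0 then 2 * q else q)"
proof (cases "(2 :: 'k) = 0")
  case True
  then have "(3 :: 'k) = 1"
    by (metis add_0 numeral_Bit1_eq_inc_double one_add_one add.right_neutral mult_zero_left numeral_Bit1 numeral_One)
  then have "{(s, y). y \<in> F \<and> s \<in> F \<and> 2 * y = 2 * (s * T) + 3 * (a * (s - s ^ 2))} = {0, 1} \<times> F"
    using True assms(2) by (auto simp: F_closed power2_eq_square)
  then show ?thesis
    using True by (simp add: card_cartesian_product card_F)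
next
  case False
  have "{y. y \<in> F \<and> 2 * y = 2 * (s * T) + 3 * (a * (s - s ^ 2))} =
    {(2 * (s * T) + (1 + 2) * (a * (s - s ^ 2))) / 2}" if "s \<in> F" for s
    using False assms that by (auto simp: field_simps intro!: F_closed)
  then have "card {(s, y). y \<in> F \<and> s \<in> F \<and> 2 * y = 2 * (s * T) + 3 * (a * (s - s ^ 2))} =
    card {s. s \<in> F} * 1"
    by (intro card_fibres) auto
  then show ?thesis
    using False by (simp add: card_F)
qed

lemma commutes_one_zero:
  assumes "c \<in> F" "d \<in> F"
  shows "commutes (((((0, 1), u), w), c), d) (((((a', s), u'), w'), c'), d') \<longleftrightarrow>
    a' = 0 \<and> Tr u' - u' = cross u s \<and> Tr w' = rhs11 0 u w s u' \<and> Tr (u * w') = rhs12 0 u w c s u' \<and>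
    c' \<in> F \<and> d' \<in> F"
  using assms by (auto simp: commutes_one F_closed)

lemma card_forget_zero:
  "card {((a' :: 'k, s), u'). a' = 0 \<and> P s u'} = card {(s :: 'k, u' :: 'k). P s u'}"
  by (rule bij_betw_same_card[of "\<lambda>((a', s), u'). (s, u')"],
    rule bij_betwI[of _ _ _ "\<lambda>(s, u'). ((0, s), u')"]) auto

text \<open>
  The traces of \<open>w'\<close> and \<open>u * w'\<close> are prescribed, which leaves \<open>q\<close> values of \<open>w'\<close>. The pairs
  \<open>(s, u')\<close> are counted by first choosing \<open>y = Tr u'\<close>: the condition on \<open>s\<close> is then
  \<open>Tr ((Tr u - u) * s) = 2 * y\<close>, with \<open>q ^ 2\<close> solutions in every characteristic.
\<close>

lemma card_centraliser_regular:
  assumes u: "u \<notin> F" and "c \<in> F" "d \<in> F"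
  shows "card {h. commutes (((((0, 1), u), w), c), d) h} = q ^ 6"
proof -
  have "card {h. commutes (((((0, 1), u), w), c), d) h} =
    card {(((((a' :: 'k, s), u'), w'), c'), d'). a' = 0 \<and> Tr u' - u' = cross u s \<and>
      Tr w' = rhs11 0 u w s u' \<and> Tr (u * w') = rhs12 0 u w c s u' \<and> c' \<in> F \<and> d' \<in> F}"
    by (rule arg_cong[of _ _ card]) (auto simp: commutes_one_zero assms)
  also have "\<dots> = card {((((a' :: 'k, s), u'), w'), c'). a' = 0 \<and> Tr u' - u' = cross u s \<and>
      Tr w' = rhs11 0 u w s u' \<and> Tr (u * w') = rhs12 0 u w c s u' \<and> c' \<in> F} * q"
    by (rule card_fibres) (auto simp: card_F)
  also have "card {((((a' :: 'k, s), u'), w'), c'). a' = 0 \<and> Tr u' - u' = cross u s \<and>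
      Tr w' = rhs11 0 u w s u' \<and> Tr (u * w') = rhs12 0 u w c s u' \<and> c' \<in> F} =
    card {(((a' :: 'k, s), u'), w'). a' = 0 \<and> Tr u' - u' = cross u s \<and>
      Tr w' = rhs11 0 u w s u' \<and> Tr (u * w') = rhs12 0 u w c s u'} * q"
    by (rule card_fibres) (auto simp: card_F)
  also have "card {(((a' :: 'k, s), u'), w'). a' = 0 \<and> Tr u' - u' = cross u s \<and>
      Tr w' = rhs11 0 u w s u' \<and> Tr (u * w') = rhs12 0 u w c s u'} =
    card {((a' :: 'k, s), u'). a' = 0 \<and> Tr u' - u' = cross u s} * q"
    by (rule card_fibres)
      (use assms in \<open>auto intro!: card_Tr_pair_fibre rhs11_F rhs12_F simp: F_closed\<close>)
  also have "card {((a' :: 'k, s), u'). a' = 0 \<and> Tr u' - u' = cross u s} =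
    card {(s, u'). Tr u' - u' = cross u s}"
    by (rule card_forget_zero)
  also have "\<dots> = card {(s, y). y \<in> F \<and> 2 * y = Tr (cross u s)}"
    using card_pairs_Tr_minus_self[of "\<lambda>s y. True"] by simp
  also have "\<dots> = card {(y, s). y \<in> F \<and> Tr ((Tr u - u) * s) = 2 * y}"
    by (rule card_pairs_swap) (use Tr_cross[of u _ 1] in \<open>auto simp: eq_commute\<close>)
  also have "\<dots> = card {y. y \<in> F} * q ^ 2"
  proof -
    have "Tr u - u \<noteq> 0"
      using u F_closed(4)[of u] by auto
    then show ?thesis
      by (intro card_fibres) (auto simp: card_Tr_mult_fibre F_closed)
  qed
  finally show ?thesis
    by (simp add: card_F eval_nat_numeral)
qed

text \<open>
  For \<open>u \<in> F\<close> the two conditions on \<open>w'\<close> are proportional. With \<open>u' = u * s + y\<close> their compatibility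
  amounts to a condition on \<open>y\<close> that does not involve \<open>s\<close>.
\<close>

lemma rhs11_minus_rhs12:
  assumes "u \<in> F" "y \<in> F"
  shows "u * rhs11 0 u w s (u * s + y) - rhs12 0 u w c s (u * s + y) = - (y * (Tr w + 3 * (u + y)))"
  using assms
  by (simp add: rhs11_def rhs12_def Tr_def adj_def cross_def F_def \<phi>_simps)
    (simp add: algebra_simps)

text \<open>
  Writing \<open>u' = u * s + y\<close>, the equation for \<open>u'\<close> becomes \<open>Tr y - y = 0\<close>, that is \<open>2 * y = 0\<close> with
  \<open>y \<in> F\<close>. Then \<open>s\<close> is free, and one trace condition on \<open>w'\<close> remains.
\<close>

lemma card_centraliser_singular:
  assumes u: "u \<in> F" and "c \<in> F" "d \<in> F"
  shows "card {h. commutes (((((0, 1), u), w), c), d) h} =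
    card {y. y \<in> F \<and> 2 * y = 0 \<and> y * (Tr w + 3 * (u + y)) = 0} * q ^ 7"
proof -
  let ?Y = "{y. y \<in> F \<and> 2 * y = 0 \<and> y * (Tr w + 3 * (u + y)) = 0}"
  have Tr_u: "Tr (u * w) = u * Tr w" for w
    using u by (simp add: Tr_F_mult)
  have "card {h. commutes (((((0, 1), u), w), c), d) h} =
    card {(((((a' :: 'k, s), u'), w'), c'), d'). a' = 0 \<and> Tr u' - u' = cross u s \<and>
      Tr w' = rhs11 0 u w s u' \<and> u * rhs11 0 u w s u' = rhs12 0 u w c s u' \<and> c' \<in> F \<and> d' \<in> F}"
    by (rule arg_cong[of _ _ card]) (auto simp: commutes_one_zero assms Tr_u)
  also have "\<dots> = card {((((a' :: 'k, s), u'), w'), c'). a' = 0 \<and> Tr u' - u' = cross u s \<and>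
      Tr w' = rhs11 0 u w s u' \<and> u * rhs11 0 u w s u' = rhs12 0 u w c s u' \<and> c' \<in> F} * q"
    by (rule card_fibres) (auto simp: card_F)
  also have "card {((((a' :: 'k, s), u'), w'), c'). a' = 0 \<and> Tr u' - u' = cross u s \<and>
      Tr w' = rhs11 0 u w s u' \<and> u * rhs11 0 u w s u' = rhs12 0 u w c s u' \<and> c' \<in> F} =
    card {(((a' :: 'k, s), u'), w'). a' = 0 \<and> Tr u' - u' = cross u s \<and>
      Tr w' = rhs11 0 u w s u' \<and> u * rhs11 0 u w s u' = rhs12 0 u w c s u'} * q"
    by (rule card_fibres) (auto simp: card_F)
  also have "card {(((a' :: 'k, s), u'), w'). a' = 0 \<and> Tr u' - u' = cross u s \<and>
      Tr w' = rhs11 0 u w s u' \<and> u * rhs11 0 u w s u' = rhs12 0 u w c s u'} =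
    card {((a' :: 'k, s), u'). a' = 0 \<and> Tr u' - u' = cross u s \<and>
      u * rhs11 0 u w s u' = rhs12 0 u w c s u'} * q ^ 2"
    by (rule card_fibres) (auto simp: card_Tr_fibre rhs11_F F_closed)
  also have "card {((a' :: 'k, s), u'). a' = 0 \<and> Tr u' - u' = cross u s \<and>
      u * rhs11 0 u w s u' = rhs12 0 u w c s u'} =
    card {(s, u'). Tr u' - u' = cross u s \<and> u * rhs11 0 u w s u' = rhs12 0 u w c s u'}"
    by (rule card_forget_zero)
  also have "\<dots> = card ((UNIV :: 'k set) \<times> ?Y)"
  proof (rule bij_betw_same_card[of "\<lambda>(s, u'). (s, u' - u * s)"],
      rule bij_betwI[of _ _ _ "\<lambda>(s, y). (s, u * s + y)"])
    have cross_u: "Tr u' - u' = cross u s \<longleftrightarrow> u' - u * s \<in> F \<and> 2 * (u' - u * s) = 0" for s u'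
    proof -
      have "cross u s = u * (Tr s - s)"
        using u by (simp add: cross_def F_def Tr_def algebra_simps)
      then have "Tr (u' - u * s) - (u' - u * s) = Tr u' - u' - cross u s"
        unfolding Tr_diff Tr_u by (simp add: right_diff_distrib)
      then show ?thesis
        by (simp only: right_minus_eq flip: Tr_eq_self_iff)
    qed
    have rhs: "u * rhs11 0 u w s (u * s + y) = rhs12 0 u w c s (u * s + y) \<longleftrightarrow>
      y * (Tr w + 3 * (u + y)) = 0" if "y \<in> F" for s y
      unfolding eq_iff_diff_eq_0[of "u * rhs11 0 u w s (u * s + y)"] rhs11_minus_rhs12[OF u that]
      by (rule neg_equal_0_iff_equal)
    show "(\<lambda>(s, u'). (s, u' - u * s)) \<in> {(s, u'). Tr u' - u' = cross u s \<and>
      u * rhs11 0 u w s u' = rhs12 0 u w c s u'} \<rightarrow> UNIV \<times> ?Y"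
    proof (clarify, intro SigmaI CollectI conjI UNIV_I)
      fix s u'
      assume *: "Tr u' - u' = cross u s" "u * rhs11 0 u w s u' = rhs12 0 u w c s u'"
      show F: "u' - u * s \<in> F" and "2 * (u' - u * s) = 0"
        using *(1) by (simp_all only: cross_u)
      show "(u' - u * s) * (Tr w + 3 * (u + (u' - u * s))) = 0"
        using rhs[OF F, of s] *(2) by simp
    qed
    show "(\<lambda>(s, y). (s, u * s + y)) \<in> UNIV \<times> ?Y \<rightarrow> {(s, u'). Tr u' - u' = cross u s \<and>
      u * rhs11 0 u w s u' = rhs12 0 u w c s u'}"
      using rhs by (auto simp: cross_u)
  qed auto
  also have "\<dots> = q ^ 3 * card ?Y"
    by (simp add: card_cartesian_product card_UNIV)
  finally show ?thesis
    by (simp add: eval_nat_numeral)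
qed

lemma sum_card_pairs_1: "(\<Sum>t\<in>UNIV. card (pairs 1 t)) = card {(g, h). tcoord g = 1 \<and> commutes g h}"
proof -
  have "card {(g, h). tcoord g = 1 \<and> commutes g h} =
    (\<Sum>t\<in>UNIV. card {p \<in> {(g, h). tcoord g = 1 \<and> commutes g h}. tcoord (snd p) = t})"
    using sum_fun_comp[of "{(g, h). tcoord g = 1 \<and> commutes g h}" UNIV "\<lambda>p. tcoord (snd p)"
        "\<lambda>_. 1 :: nat"] by simp
  also have "\<dots> = (\<Sum>t\<in>UNIV. card (pairs 1 t))"
    unfolding pairs_def by (intro sum.cong refl arg_cong[of _ _ card]) (simp add: conj_ac case_prod_unfold)
  finally show ?thesis ..
qed

text \<open>
  The number of admissible \<open>y\<close> in the case \<open>a = 0\<close>, \<open>u \<in> F\<close> depends on the first element; there the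
  order of summation is changed. For \<open>y = 0\<close> the condition on \<open>(u, w)\<close> is vacuous, and for the other
  \<open>\<kappa> - 1\<close> values of \<open>y\<close> it prescribes the trace of \<open>w\<close>. The summands on the left avoid subtraction of
  natural numbers.
\<close>

lemma card_pairs_1:
  defines "\<kappa> \<equiv> card {y \<in> F. 2 * y = 0}"
  shows "card {(g, h). tcoord g = 1 \<and> commutes g h} + q ^ 12 + q ^ 12 =
    (if (2 :: 'k) = 0 then 2 else 1) * (q - 1) * q ^ 12 + q ^ 14 + q ^ 13 + \<kappa> * q ^ 12"
proof -
  define P where "P g h \<longleftrightarrow> tcoord g = 1 \<and> commutes g h" for g h
  define A :: "'k coords \<Rightarrow> bool" where "A = (\<lambda>(((((a, t), u), w), c), d). a \<noteq> 0)"
  define B :: "'k coords \<Rightarrow> bool" where "B = (\<lambda>(((((a, t), u), w), c), d). u \<notin> F)"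
  have generic: "card {(g, h). P g h \<and> A g} = (if (2 :: 'k) = 0 then 2 else 1) * (q - 1) * q ^ 12"
  proof -
    have "card {(g, h). P g h \<and> A g} = card {g. g \<in> U \<and> tcoord g = 1 \<and> A g} *
      ((if (2 :: 'k) = 0 then 2 * q else q) * q ^ 3)"
    proof (rule card_fibres)
      fix g assume "g \<in> U \<and> tcoord g = 1 \<and> A g"
      then obtain a u w c d where "g = (((((a, 1), u), w), c), d)" "a \<in> F" "a \<noteq> 0" "c \<in> F" "d \<in> F"
        by (cases g) (auto simp: U_def A_def)
      then show "card {h. P g h \<and> A g} = (if (2 :: 'k) = 0 then 2 * q else q) * q ^ 3"
        by (simp add: P_def A_def card_centraliser_generic card_quadratic F_closed)
    qed (simp add: P_def commutes_def)
    also have "{g. g \<in> U \<and> tcoord g = 1 \<and> A g} = (((((F - {0}) \<times> {1}) \<times> UNIV) \<times> UNIV) \<times> F) \<times> F"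
      by (auto simp: U_def A_def)
    finally show ?thesis
      by (simp add: card_cartesian_product card_F card_UNIV card_Diff_subset F_closed eval_nat_numeral mult_ac)
  qed
  have regular: "card {(g, h). (P g h \<and> \<not> A g) \<and> B g} + q ^ 12 = q ^ 14"
  proof -
    have "card {(g, h). (P g h \<and> \<not> A g) \<and> B g} =
      card {g. (g \<in> U \<and> tcoord g = 1 \<and> \<not> A g) \<and> B g} * q ^ 6"
    proof (rule card_fibres)
      fix g assume "(g \<in> U \<and> tcoord g = 1 \<and> \<not> A g) \<and> B g"
      then obtain u w c d where "g = (((((0, 1), u), w), c), d)" "u \<notin> F" "c \<in> F" "d \<in> F"
        by (cases g) (auto simp: U_def A_def B_def)
      then show "card {h. (P g h \<and> \<not> A g) \<and> B g} = q ^ 6"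
        by (simp add: P_def A_def B_def card_centraliser_regular)
    qed (simp add: P_def commutes_def)
    also have "{g. (g \<in> U \<and> tcoord g = 1 \<and> \<not> A g) \<and> B g} =
      (((({0} \<times> {1}) \<times> (UNIV - F)) \<times> UNIV) \<times> F) \<times> F"
      by (auto simp: U_def A_def B_def F_closed)
    also have "card \<dots> = (q ^ 3 - q) * q ^ 5"
      by (simp add: card_cartesian_product card_F card_UNIV card_Diff_subset eval_nat_numeral mult_ac)
    moreover have "(q ^ 3 - q) * q ^ 5 * q ^ 6 + q ^ 12 = q ^ 14"
      using q_gt_1 power_increasing[of 12 14 q]
      by (simp add: diff_mult_distrib flip: power_add power_Suc)
    ultimately show ?thesis
      by simp
  qed
  have singular: "card {(g, h). (P g h \<and> \<not> A g) \<and> \<not> B g} + q ^ 12 = q ^ 13 + \<kappa> * q ^ 12"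
  proof -
    define Q :: "'k \<Rightarrow> 'k coords \<Rightarrow> bool" where
      "Q y = (\<lambda>(((((a, t), u), w), c), d). a = 0 \<and> t = 1 \<and> u \<in> F \<and> c \<in> F \<and> d \<in> F \<and>
        y \<in> F \<and> 2 * y = 0 \<and> y * (Tr w + 3 * (u + y)) = 0)" for y
    have "card {(g, h). (P g h \<and> \<not> A g) \<and> \<not> B g} = card {(g, y). Q y g} * q ^ 7"
    proof (rule card_fibres_transfer)
      fix g
      show "card {h. (P g h \<and> \<not> A g) \<and> \<not> B g} = card {y. Q y g} * q ^ 7"
      proof (cases "g \<in> U \<and> tcoord g = 1 \<and> \<not> A g \<and> \<not> B g")
        case True
        then obtain u w c d where "g = (((((0, 1), u), w), c), d)" "u \<in> F" "c \<in> F" "d \<in> F"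
          by (cases g) (auto simp: U_def A_def B_def)
        then show ?thesis
          by (simp add: P_def A_def B_def Q_def card_centraliser_singular)
      next
        case False
        then have "\<not> Q y g" for y
          by (cases g) (auto simp: U_def A_def B_def Q_def F_closed)
        moreover have "\<not> ((P g h \<and> \<not> A g) \<and> \<not> B g)" for h
          using False by (simp add: P_def commutes_def)
        ultimately show ?thesis
          by simp
      qed
    qed
    also have "card {(g, y). Q y g} = card {(y, g). Q y g}"
      by (rule bij_betw_same_card[of prod.swap]) (auto simp: bij_betw_def)
    also have "\<dots> = card {(y, g). Q y g \<and> y = 0} + card {(y, g). Q y g \<and> y \<noteq> 0}"
      using card_Collect_split[of "\<lambda>(y, g). Q y g" "\<lambda>(y, g). y = 0"]
      by (simp only: case_prod_unfold)
    also have "card {(y, g). Q y g \<and> y = 0} = card {y :: 'k. y = 0} * q ^ 6"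
    proof (rule card_fibres)
      fix y :: 'k assume "y = 0"
      then have "{g. Q y g \<and> y = 0} = (((({0} \<times> {1}) \<times> F) \<times> UNIV) \<times> F) \<times> F"
        by (auto simp: Q_def F_closed)
      then show "card {g. Q y g \<and> y = 0} = q ^ 6"
        by (simp add: card_cartesian_product card_F card_UNIV eval_nat_numeral mult_ac)
    qed simp
    also have "card {(y, g). Q y g \<and> y \<noteq> 0} = card {y. (y \<in> F \<and> 2 * y = 0) \<and> y \<noteq> 0} * q ^ 5"
    proof (rule card_fibres)
      fix y assume y: "(y \<in> F \<and> 2 * y = 0) \<and> y \<noteq> 0"
      have "card {g. Q y g \<and> y \<noteq> 0} = card {(((((a :: 'k, t :: 'k), u), w), c), d).
        a = 0 \<and> t = 1 \<and> u \<in> F \<and> Tr w = - (3 * (u + y)) \<and> c \<in> F \<and> d \<in> F}"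
        using y by (intro arg_cong[of _ _ card]) (auto simp: Q_def eq_neg_iff_add_eq_0 simp del: distrib_left_numeral)
      also have "\<dots> = card {((((a :: 'k, t :: 'k), u), w), c).
        a = 0 \<and> t = 1 \<and> u \<in> F \<and> Tr w = - (3 * (u + y)) \<and> c \<in> F} * q"
        by (rule card_fibres) (auto simp: card_F)
      also have "card {((((a :: 'k, t :: 'k), u), w), c).
          a = 0 \<and> t = 1 \<and> u \<in> F \<and> Tr w = - (3 * (u + y)) \<and> c \<in> F} =
        card {(((a :: 'k, t :: 'k), u), w). a = 0 \<and> t = 1 \<and> u \<in> F \<and> Tr w = - (3 * (u + y))} * q"
        by (rule card_fibres) (auto simp: card_F)
      also have "card {(((a :: 'k, t :: 'k), u), w). a = 0 \<and> t = 1 \<and> u \<in> F \<and> Tr w = - (3 * (u + y))} =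
        card {((a :: 'k, t :: 'k), u). a = 0 \<and> t = 1 \<and> u \<in> F} * q ^ 2"
        by (rule card_fibres) (use y in \<open>auto intro!: card_Tr_fibre F_closed\<close>)
      also have "{((a :: 'k, t :: 'k), u). a = 0 \<and> t = 1 \<and> u \<in> F} = ({0} \<times> {1}) \<times> F"
        by auto
      finally show "card {g. Q y g \<and> y \<noteq> 0} = q ^ 5"
        by (simp add: card_cartesian_product card_F eval_nat_numeral)
    qed (auto simp: Q_def)
    also have "card {y. (y \<in> F \<and> 2 * y = 0) \<and> y \<noteq> 0} = \<kappa> - 1"
    proof -
      have "{y. (y \<in> F \<and> 2 * y = 0) \<and> y \<noteq> 0} = {y \<in> F. 2 * y = 0} - {0}"
        by auto
      then show ?thesis
        by (simp add: \<kappa>_def F_closed)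
    qed
    finally have "card {(g, h). (P g h \<and> \<not> A g) \<and> \<not> B g} = (q ^ 6 + (\<kappa> - 1) * q ^ 5) * q ^ 7"
      by simp
    moreover have "\<kappa> \<ge> 1"
    proof -
      have "card {0 :: 'k} \<le> \<kappa>"
        unfolding \<kappa>_def by (rule card_mono) (auto simp: F_closed)
      then show ?thesis by simp
    qed
    then obtain k where "\<kappa> = Suc k"
      by (cases \<kappa>) auto
    then have "(q ^ 6 + (\<kappa> - 1) * q ^ 5) * q ^ 7 + q ^ 12 = q ^ 13 + \<kappa> * q ^ 12"
      by (simp add: distrib_right mult.assoc flip: power_add)
    ultimately show ?thesis
      by simp
  qed
  have "card {(g, h). P g h} = card {(g, h). P g h \<and> A g} + card {(g, h). P g h \<and> \<not> A g}"
    using card_Collect_split[of "\<lambda>(g, h). P g h" "\<lambda>(g, h). A g"]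
    by (simp only: case_prod_unfold)
  moreover have "card {(g, h). P g h \<and> \<not> A g} =
    card {(g, h). (P g h \<and> \<not> A g) \<and> B g} + card {(g, h). (P g h \<and> \<not> A g) \<and> \<not> B g}"
    using card_Collect_split[of "\<lambda>(g, h). P g h \<and> \<not> A g" "\<lambda>(g, h). B g"]
    by (simp only: case_prod_unfold)
  ultimately have "card {(g, h). P g h} + q ^ 12 + q ^ 12 = card {(g, h). P g h \<and> A g} +
    (card {(g, h). (P g h \<and> \<not> A g) \<and> B g} + q ^ 12) +
    (card {(g, h). (P g h \<and> \<not> A g) \<and> \<not> B g} + q ^ 12)"
    by (simp only: add_ac)
  also have "\<dots> = (if (2 :: 'k) = 0 then 2 else 1) * (q - 1) * q ^ 12 + q ^ 14 + q ^ 13 + \<kappa> * q ^ 12"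
    unfolding generic regular singular by (simp only: add.assoc)
  finally show ?thesis
    unfolding P_def .
qed

section \<open>The class number\<close>

lemma class_number_triality:
  fixes G :: "('a, 'b) monoid_scheme" (structure) and x :: "nat \<Rightarrow> 'k \<Rightarrow> 'a"
  assumes "UD4_triality G x q \<sigma>"
  shows "class_number (fixed_subgroup G \<sigma>) * q ^ 12 = card {(g, h). commutes g h}"
proof -
  interpret UD4_triality G x q \<sigma>
    by (rule assms)
  let ?H = "fixed_subgroup G \<sigma>" and ?f = "\<lambda>g. root_product (embed g)"
  interpret H: group ?H
    by (rule group_fixed_subgroup) (rule \<sigma>_iso)
  have inj: "inj ?f"
    using inj_compose[OF bij_betw_imp_inj_on[OF bij_root_product] inj_embed] by (simp add: comp_def)
  have carrier: "carrier ?H = ?f ` U"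
    by (simp only: carrier_fixed_subgroup image_image flip: embed_U)
  have mult: "?f g \<otimes>\<^bsub>?H\<^esub> ?f h = ?f (mult g h)" if "g \<in> U" "h \<in> U" for g h
    using root_product_mult[of "embed g" "embed h"] embed_mult[OF that]
    by (simp add: fixed_subgroup_def)
  show ?thesis
    using H.class_number_coordinates[OF inj carrier finite mult]
    unfolding commutes_def card_U .
qed

text \<open>
  The contributions to the commuting pairs are added and divided by \<open>q ^ 12\<close>. Characteristic 2
  enters through \<open>\<kappa>\<close>, the number of \<open>y\<close> in \<open>F\<close> with \<open>2 * y = 0\<close>, and through the number of solutions in
  \<open>card_quadratic\<close>.
\<close>

lemma class_number_formula:
  fixes G :: "('a, 'b) monoid_scheme" (structure) and x :: "nat \<Rightarrow> 'k \<Rightarrow> 'a"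
  assumes "UD4_triality G x q \<sigma>"
  shows "int (class_number (fixed_subgroup G \<sigma>)) =
    (if (2 :: 'k) = 0 then 2 * int q ^ 5 + 5 * int q ^ 4 - 4 * int q ^ 3 - int q ^ 2 - 4 * int q + 3
     else 2 * int q ^ 5 + 2 * int q ^ 4 - int q ^ 3 - int q ^ 2 - int q)"
proof -
  define k where "k = class_number (fixed_subgroup G \<sigma>)"
  define \<kappa> where "\<kappa> = card {y \<in> F. 2 * y = 0}"
  define S where "S = card {(g, h). tcoord g = 1 \<and> commutes g h}"
  have \<kappa>: "\<kappa> = (if (2 :: 'k) = 0 then q else 1)"
  proof (cases "(2 :: 'k) = 0")
    case False
    then have "{y \<in> F. 2 * y = 0} = {0}"
      by (auto simp: F_closed)
    then show ?thesis
      using False by (simp add: \<kappa>_def)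
  qed (simp add: \<kappa>_def card_F)
  have q: "q \<ge> 1" "q ^ 3 \<ge> 1"
    using q_gt_1 by simp_all
  have "int (k * q ^ 12) = int (card (pairs 0 0)) + (int q ^ 3 - 1) * (int (card (pairs 1 0)) + int S)"
    using class_number_triality[OF assms] card_commuting_pairs q
    by (simp add: k_def S_def sum_card_pairs_1 of_nat_diff)
  moreover have "int (card (pairs 0 0)) = int q ^ 10 + int q ^ 17 - int q ^ 9"
    using arg_cong[OF card_pairs_0_0, of int] by simp
  moreover have "int (card (pairs 1 0)) = int q ^ 10 + int \<kappa> * int q ^ 12 - int q ^ 9"
    using arg_cong[OF card_pairs_1_0, of int] by (simp add: \<kappa>_def)
  moreover have "int S = (if (2 :: 'k) = 0 then 2 else 1) * (int q - 1) * int q ^ 12 + int q ^ 14 +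
    int q ^ 13 + int \<kappa> * int q ^ 12 - 2 * int q ^ 12"
    using arg_cong[OF card_pairs_1, of int] q by (auto simp: \<kappa>_def S_def of_nat_diff)
  ultimately have "int k * int q ^ 12 = int q ^ 10 + int q ^ 17 - int q ^ 9 + (int q ^ 3 - 1) *
    (int q ^ 10 + int \<kappa> * int q ^ 12 - int q ^ 9 + ((if (2 :: 'k) = 0 then 2 else 1) * (int q - 1) * int q ^ 12 +
      int q ^ 14 + int q ^ 13 + int \<kappa> * int q ^ 12 - 2 * int q ^ 12))"
    by simp
  also have "\<dots> =
    (if (2 :: 'k) = 0 then 2 * int q ^ 5 + 5 * int q ^ 4 - 4 * int q ^ 3 - int q ^ 2 - 4 * int q + 3
     else 2 * int q ^ 5 + 2 * int q ^ 4 - int q ^ 3 - int q ^ 2 - int q) * int q ^ 12"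
    unfolding \<kappa> by (simp add: algebra_simps eval_nat_numeral)
  finally show ?thesis
    using q by (simp add: k_def)
qed

end

theorem corollary1p2:
  fixes G :: "('a, 'b) monoid_scheme"
    and x :: "nat \<Rightarrow> 'k::finite_field \<Rightarrow> 'a"
    and \<sigma> :: "'a \<Rightarrow> 'a"
    and p q m :: nat
  assumes "prime p" and "m \<ge> 1" and "q = p ^ m"
    and "card (UNIV :: 'k set) = q ^ 3"
    and "UD4_triality G x q \<sigma>"
  shows
    "(odd q \<longrightarrow> int (class_number (fixed_subgroup G \<sigma>)) =
        2 * int q ^ 5 + 2 * int q ^ 4 - int q ^ 3 - int q ^ 2 - int q) \<and>
     (even q \<longrightarrow> int (class_number (fixed_subgroup G \<sigma>)) =
        2 * int q ^ 5 + 5 * int q ^ 4 - 4 * int q ^ 3 - int q ^ 2 - 4 * int q + 3)"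
proof -
  have prime_char: "prime CHAR('k)"
    by (simp add: prime_CHAR_semidom finite_imp_CHAR_pos)
  have "CHAR('k) dvd p ^ (m * 3)"
    using CHAR_dvd_CARD[where 'a = 'k] assms(3,4) by (simp add: power_mult)
  then have char: "CHAR('k) = p"
    using prime_char \<open>prime p\<close> by (meson prime_dvd_power primes_dvd_imp_eq)
  have "(s + t) ^ q = s ^ q + t ^ q" for s t :: 'k
    by (rule freshmans_dream'[OF prime_char]) (simp add: char assms(3))
  then interpret cubic_extension q "\<lambda>t :: 'k. t ^ q"
    by unfold_locales (use assms(4) in auto)
  have "even q \<longleftrightarrow> p = 2"
    using assms(1-3) primes_dvd_imp_eq[OF two_is_prime_nat] by auto
  also have "\<dots> \<longleftrightarrow> (2 :: 'k) = 0"
    using of_nat_eq_0_iff_char_dvd[where 'a = 'k, of 2] char assms(1)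
      primes_dvd_imp_eq[OF assms(1) two_is_prime_nat] by auto
  finally show ?thesis
    using class_number_formula[OF assms(5)] by auto
qed

end
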